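(* Let $\gamma_1\in\mathbb{R}$, let $\xi_1,\xi_2,\dots$ be independent random variables each uniformly distributed over $[2,3]$, define $\gamma_{j+1}:=\gamma_j+1+\xi_j$ for $j\in\mathbb{N}$, and set $S:=\bigcup_{j=1}^\infty[\gamma_j,\gamma_j+1]$. Then with probability one, no uniformly discrete set $\Lambda\subset\mathbb{R}$ is a uniqueness set for $W^{(\alpha)}_S$ (for $\alpha>1/2$).
   Context: Fourier transform: $\hat f(t)=\int e^{-2\pi i t x}f(x)\,dx$. For $\alpha>1/2$, $W^{(\alpha)}_S$ is the space of functions $f$ whose Fourier transform $F=\hat f$ satisfies $\int_{\mathbb{R}}(1+|t|^{2\alpha})|F(t)|^2\,dt<\infty$ and $F=0$ a.e. outside $S$ (such $f$ are continuous). A set $\Lambda$ is uniformly discrete if $\inf\{|\lambda-\lambda'|:\lambda\neq\lambda'\in\Lambda\}>0$. $\Lambda$ is a uniqueness set for a space of continuous functions if the only function in it vanishing on $\Lambda$ is zero. *)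

theory Defs
  imports "HOL-Probability.Probability"
begin

text \<open>Fourier convention: hat f(t) = integral of exp(-2 pi i t x) f(x) dx, so
  f is recovered from F = hat f by f(x) = integral of exp(2 pi i t x) F(t) dt.\<close>

definition inv_fourier :: "(real \<Rightarrow> complex) \<Rightarrow> real \<Rightarrow> complex" where
  "inv_fourier F x = (\<integral>t. cis (2 * pi * t * x) * F t \<partial>lborel)"

definition W_space :: "real \<Rightarrow> real set \<Rightarrow> (real \<Rightarrow> complex) set" where
  "W_space \<alpha> S = {f. \<exists>F. F \<in> borel_measurable lborel
      \<and> (\<integral>\<^sup>+ t. ennreal ((1 + \<bar>t\<bar> powr (2 * \<alpha>)) * (cmod (F t))\<^sup>2) \<partial>lborel) < \<infinity>
      \<and> (AE t in lborel. t \<notin> S \<longrightarrow> F t = 0)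
      \<and> f = inv_fourier F}"

definition uniformly_discrete :: "real set \<Rightarrow> bool" where
  "uniformly_discrete \<Lambda> \<longleftrightarrow> (\<exists>\<delta>>0. \<forall>x\<in>\<Lambda>. \<forall>y\<in>\<Lambda>. x \<noteq> y \<longrightarrow> \<delta> \<le> \<bar>x - y\<bar>)"

definition uniqueness_set :: "real set \<Rightarrow> (real \<Rightarrow> complex) set \<Rightarrow> bool" where
  "uniqueness_set \<Lambda> V \<longleftrightarrow> (\<forall>f\<in>V. (\<forall>x\<in>\<Lambda>. f x = 0) \<longrightarrow> f = (\<lambda>_. 0))"

text \<open>gam g1 xi 0 = gamma_1 and gam g1 xi (Suc j) = gamma_{j+2}; xi j is xi_{j+1}.\<close>

primrec gam :: "real \<Rightarrow> (nat \<Rightarrow> 'a \<Rightarrow> real) \<Rightarrow> 'a \<Rightarrow> nat \<Rightarrow> real" where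
  "gam g1 \<xi> \<omega> 0 = g1"
| "gam g1 \<xi> \<omega> (Suc j) = gam g1 \<xi> \<omega> j + 1 + \<xi> j \<omega>"

definition rand_set :: "real \<Rightarrow> (nat \<Rightarrow> 'a \<Rightarrow> real) \<Rightarrow> 'a \<Rightarrow> real set" where
  "rand_set g1 \<xi> \<omega> = (\<Union>j. {gam g1 \<xi> \<omega> j .. gam g1 \<xi> \<omega> j + 1})"

end

theory Submission
  imports Defs
begin

text \<open>Consider the averages \<open>m\<^sub>J(x)\<close> of \<open>e(\<gamma>\<^sub>j x) = exp(2\<pi>i\<gamma>\<^sub>j x)\<close> over finite sets \<open>J\<close> of indices.
  There are finite sequences of admissible gaps for which a suitable such average is at most \<open>\<eta>\<close> in
  modulus on \<open>\<delta> \<le> |x| \<le> R\<close>: passing from a set \<open>A\<close> of frequencies to \<open>A \<union> (A + r)\<close> multiplies the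
  average by \<open>(1 + e(rx))/2\<close>, and of the two factors for \<open>r\<close> and \<open>2r + \<beta>\<close>, with \<open>\<beta>\<close> small, at least
  one is bounded away from 1 in modulus. By independence, almost surely every such sequence occurs
  among the random gaps up to a small error.

  Let \<open>\<Lambda>\<close> be \<open>\<delta>\<close>-separated, with one extra point \<open>x\<^sub>0\<close> added, and let \<open>K\<close> be the inverse Fourier
  transform of the average over \<open>J\<close> of translates of a fixed bump supported in \<open>[0,1]\<close>. Then \<open>K\<close> is
  \<open>m\<^sub>J\<close> times a function with cubic decay, so \<open>K(0) = 1\<close> and \<open>|K(x)| \<le> \<kappa>/x\<^sup>2\<close> for \<open>|x| \<ge> \<delta>\<close> with \<open>\<kappa>\<close>
  as small as desired. Hence the matrix \<open>K(\<lambda> - \<mu>)\<close> is a perturbation of the identity of norm at most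
  1/2 on \<open>\<ell>\<^sup>1\<close>, and some combination \<open>\<Sum> c\<^sub>\<mu> K(x - \<mu>)\<close> equals 1 at \<open>x\<^sub>0\<close> and vanishes on the rest of \<open>\<Lambda>\<close>.\<close>

section \<open>Exponential means\<close>

definition exp_mean :: "('i \<Rightarrow> real) \<Rightarrow> 'i set \<Rightarrow> real \<Rightarrow> complex" where
  "exp_mean \<gamma> J x = (\<Sum>j\<in>J. cis (2 * pi * \<gamma> j * x)) / of_nat (card J)"

lemma exp_mean_0: "finite J \<Longrightarrow> J \<noteq> {} \<Longrightarrow> exp_mean \<gamma> J 0 = 1"
  by (simp add: exp_mean_def)

lemma norm_exp_mean_le_1: "cmod (exp_mean \<gamma> J x) \<le> 1"
proof -
  have "cmod (\<Sum>j\<in>J. cis (2 * pi * \<gamma> j * x)) \<le> card J"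
    using sum_norm_le[of J "\<lambda>j. cis (2 * pi * \<gamma> j * x)" "\<lambda>_. 1"] by simp
  then show ?thesis
    by (cases "card J = 0") (simp_all add: exp_mean_def norm_divide)
qed

lemma exp_mean_translate:
  "exp_mean (\<lambda>j. a + \<gamma> j) J x = cis (2 * pi * a * x) * exp_mean \<gamma> J x"
  by (simp add: exp_mean_def sum_distrib_left cis_mult distrib_left distrib_right)

lemma exp_mean_reindex:
  "inj_on f J \<Longrightarrow> exp_mean \<gamma> (f ` J) x = exp_mean (\<lambda>j. \<gamma> (f j)) J x"
  by (simp add: exp_mean_def sum.reindex card_image)

lemma exp_mean_Un_disjoint:
  assumes "finite J" "finite K" "J \<inter> K = {}" "card J = card K"
  shows "exp_mean \<gamma> (J \<union> K) x = (exp_mean \<gamma> J x + exp_mean \<gamma> K x) / 2"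
  using assms
  by (simp add: exp_mean_def sum.union_disjoint card_Un_disjoint add_divide_distrib field_simps)

lemma norm_cis_diff_le: "cmod (cis a - cis b) \<le> \<bar>a - b\<bar>"
proof -
  have "cis a - cis b = cis b * (exp (\<i> * of_real (a - b)) - 1)"
    by (simp add: cis_conv_exp right_diff_distrib flip: exp_add)
  then have "cmod (cis a - cis b) = 2 * \<bar>sin ((a - b) / 2)\<bar>"
    by (simp only: norm_mult norm_cis dist_exp_i_1)
  also have "\<dots> \<le> 2 * \<bar>(a - b) / 2\<bar>"
    by (intro mult_left_mono abs_sin_x_le_abs_x) auto
  finally show ?thesis by simp
qed

lemma norm_exp_mean_diff_le:
  assumes close: "\<And>j. j \<in> J \<Longrightarrow> \<bar>\<gamma> j - \<gamma>' j\<bar> \<le> r" and "0 \<le> r"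
  shows "cmod (exp_mean \<gamma> J x - exp_mean \<gamma>' J x) \<le> 2 * pi * r * \<bar>x\<bar>"
proof -
  have "cmod (cis (2 * pi * \<gamma> j * x) - cis (2 * pi * \<gamma>' j * x)) \<le> 2 * pi * r * \<bar>x\<bar>" if "j \<in> J" for j
  proof -
    have "cmod (cis (2 * pi * \<gamma> j * x) - cis (2 * pi * \<gamma>' j * x)) \<le> \<bar>2 * pi * (\<gamma> j - \<gamma>' j) * x\<bar>"
      using norm_cis_diff_le[of "2 * pi * \<gamma> j * x" "2 * pi * \<gamma>' j * x"]
      by (simp add: algebra_simps)
    also have "\<dots> \<le> 2 * pi * r * \<bar>x\<bar>"
      using close[OF that] by (simp add: abs_mult mult_right_mono)
    finally show ?thesis .
  qed
  then have "cmod (\<Sum>j\<in>J. cis (2 * pi * \<gamma> j * x) - cis (2 * pi * \<gamma>' j * x))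
      \<le> card J * (2 * pi * r * \<bar>x\<bar>)"
    by (rule sum_norm_bound)
  moreover have "exp_mean \<gamma> J x - exp_mean \<gamma>' J x =
      (\<Sum>j\<in>J. cis (2 * pi * \<gamma> j * x) - cis (2 * pi * \<gamma>' j * x)) / of_nat (card J)"
    by (simp add: exp_mean_def sum_subtractf diff_divide_distrib)
  ultimately show ?thesis
    using \<open>0 \<le> r\<close> by (cases "card J = 0") (simp_all add: norm_divide pos_divide_le_eq mult_ac)
qed

definition vanishing_exp_means :: "('i \<Rightarrow> real) \<Rightarrow> bool" where
  "vanishing_exp_means \<gamma> \<longleftrightarrow> (\<forall>\<epsilon>>0. \<exists>J. finite J \<and> J \<noteq> {} \<and>
     (\<forall>x. \<epsilon> \<le> \<bar>x\<bar> \<and> \<bar>x\<bar> \<le> 1 / \<epsilon> \<longrightarrow> cmod (exp_mean \<gamma> J x) \<le> \<epsilon>))"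

lemma vanishing_exp_meansI_Suc:
  assumes "\<And>n. \<exists>J. finite J \<and> J \<noteq> {} \<and> (\<forall>x. 1 / real (Suc n) \<le> \<bar>x\<bar> \<and> \<bar>x\<bar> \<le> real (Suc n) \<longrightarrow>
    cmod (exp_mean \<gamma> J x) \<le> 1 / real (Suc n))"
  shows "vanishing_exp_means \<gamma>"
  unfolding vanishing_exp_means_def
proof (intro allI impI)
  fix \<epsilon> :: real assume "0 < \<epsilon>"
  then obtain n where Suc_n: "1 / real (Suc n) < \<epsilon>"
    by (metis inverse_eq_divide reals_Archimedean)
  then have "1 / \<epsilon> < real (Suc n)"
    using \<open>0 < \<epsilon>\<close> by (simp add: field_simps del: of_nat_Suc)
  with Suc_n show "\<exists>J. finite J \<and> J \<noteq> {} \<and>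
      (\<forall>x. \<epsilon> \<le> \<bar>x\<bar> \<and> \<bar>x\<bar> \<le> 1 / \<epsilon> \<longrightarrow> cmod (exp_mean \<gamma> J x) \<le> \<epsilon>)"
    using assms[of n] by (meson dual_order.trans less_imp_le)
qed

lemma vanishing_exp_means_translate:
  "vanishing_exp_means (\<lambda>j. a + \<gamma> j) \<longleftrightarrow> vanishing_exp_means \<gamma>"
  by (simp add: vanishing_exp_means_def exp_mean_translate norm_mult)

lemma vanishing_exp_means_le_linear:
  assumes vanishing: "vanishing_exp_means \<gamma>" and pos: "0 < \<delta>" "0 < \<kappa>"
  obtains J where "finite J" "J \<noteq> {}" "\<forall>x. \<delta> \<le> \<bar>x\<bar> \<longrightarrow> cmod (exp_mean \<gamma> J x) \<le> \<kappa> * \<bar>x\<bar>"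
proof -
  define \<epsilon> where "\<epsilon> = min \<delta> (min (\<kappa> * \<delta>) \<kappa>)"
  have eps_bounds: "0 < \<epsilon>" "\<epsilon> \<le> \<delta>" "\<epsilon> \<le> \<kappa> * \<delta>" "\<epsilon> \<le> \<kappa>"
    using pos by (simp_all add: \<epsilon>_def)
  obtain J where J_finite: "finite J" "J \<noteq> {}"
    and small: "\<And>x. \<epsilon> \<le> \<bar>x\<bar> \<Longrightarrow> \<bar>x\<bar> \<le> 1 / \<epsilon> \<Longrightarrow> cmod (exp_mean \<gamma> J x) \<le> \<epsilon>"
    using vanishing[unfolded vanishing_exp_means_def, rule_format, OF eps_bounds(1)] by blast
  have "cmod (exp_mean \<gamma> J x) \<le> \<kappa> * \<bar>x\<bar>" if "\<delta> \<le> \<bar>x\<bar>" for x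
  proof (cases "\<bar>x\<bar> \<le> 1 / \<epsilon>")
    case True
    have "\<kappa> * \<delta> \<le> \<kappa> * \<bar>x\<bar>" using that pos by simp
    then show ?thesis using small[OF _ True] that eps_bounds by linarith
  next
    case False
    then have "1 \<le> \<epsilon> * \<bar>x\<bar>" using eps_bounds(1) by (simp add: field_simps)
    also have "\<dots> \<le> \<kappa> * \<bar>x\<bar>" using eps_bounds(4) by (rule mult_right_mono) simp
    finally show ?thesis using norm_exp_mean_le_1[of \<gamma> J x] by linarith
  qed
  with J_finite show ?thesis using that by blast
qed

section \<open>Step patterns with small exponential means\<close>

definition step_sums :: "real list \<Rightarrow> nat \<Rightarrow> real" where
  "step_sums d k = sum_list (take k d)"

definition step_pattern :: "real set \<Rightarrow> real list \<Rightarrow> nat set \<Rightarrow> bool" where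
  "step_pattern D d J \<longleftrightarrow> set d \<subseteq> D \<and> J \<subseteq> {..length d} \<and> J \<noteq> {}"

lemma step_sums_append:
  "k \<le> length d \<Longrightarrow> step_sums (d @ e) k = step_sums d k"
  "step_sums (d @ e) (length d + k) = sum_list d + step_sums e k"
  by (simp_all add: step_sums_def)

lemma step_pattern_finite: "step_pattern D d J \<Longrightarrow> finite J"
  using finite_subset[of J "{..length d}"] by (simp add: step_pattern_def)

lemma norm_one_plus_cis: "cmod (1 + cis (2 * u)) = 2 * \<bar>cos u\<bar>"
proof -
  have "1 + cis (2 * u) = cis u * (2 * cos u)"
    by (simp add: complex_eq_iff cos_double_cos sin_double power2_eq_square)
  then show ?thesis by (simp add: norm_mult)
qed

lemma step_pattern_double:
  assumes pattern: "step_pattern D d J" and e_steps: "set e \<subseteq> D" "e \<noteq> []"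
  obtains d' J' where "step_pattern D d' J'" "sum_list d' = 2 * sum_list d + sum_list e"
    "\<And>x. cmod (exp_mean (step_sums d') J' x) =
       cmod (exp_mean (step_sums d) J x) * \<bar>cos (pi * (sum_list d + sum_list e) * x)\<bar>"
proof
  let ?d' = "d @ e @ d" and ?r = "sum_list d + sum_list e"
  let ?K = "(+) (length d + length e) ` J"
  have le_length: "k \<le> length d" if "k \<in> J" for k
    using pattern that by (auto simp: step_pattern_def)
  show "step_pattern D ?d' (J \<union> ?K)"
    using pattern e_steps by (auto simp: step_pattern_def intro: trans_le_add1)
  show "sum_list ?d' = 2 * sum_list d + sum_list e"
    by simp
  fix x :: real
  have "exp_mean (step_sums ?d') J x = exp_mean (step_sums d) J x"
    unfolding exp_mean_def
    by (intro arg_cong2[where f = "(/)"] sum.cong) (simp_all add: step_sums_append le_length)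
  moreover have "exp_mean (step_sums ?d') ?K x = cis (2 * (pi * ?r * x)) * exp_mean (step_sums d) J x"
  proof -
    have "step_sums ?d' (length d + length e + k) = ?r + step_sums d k" for k
      using step_sums_append(2)[of d "e @ d" "length e + k"] step_sums_append(2)[of e d k]
      by (simp add: add.assoc)
    then show ?thesis
      by (simp add: exp_mean_reindex exp_mean_translate mult.assoc)
  qed
  moreover have "exp_mean (step_sums ?d') (J \<union> ?K) x =
      (exp_mean (step_sums ?d') J x + exp_mean (step_sums ?d') ?K x) / 2"
  proof (rule exp_mean_Un_disjoint)
    show "finite J" using pattern by (rule step_pattern_finite)
    then show "finite ?K" by simp
    show "J \<inter> ?K = {}" using e_steps(2) by (fastforce dest: le_length)
    show "card J = card ?K" by (simp add: card_image)
  qed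
  ultimately have "exp_mean (step_sums ?d') (J \<union> ?K) x =
      exp_mean (step_sums d) J x * ((1 + cis (2 * (pi * ?r * x))) / 2)"
    by (simp add: algebra_simps)
  then show "cmod (exp_mean (step_sums ?d') (J \<union> ?K) x) =
      cmod (exp_mean (step_sums d) J x) * \<bar>cos (pi * ?r * x)\<bar>"
    by (simp only: norm_mult norm_divide norm_one_plus_cis) simp
qed

lemma exists_steps_with_sum:
  fixes a b r :: real
  assumes "0 < a" "a < b" "a * b / (b - a) \<le> r"
  obtains e where "set e \<subseteq> {a..b}" "e \<noteq> []" "sum_list e = r"
proof
  define n where "n = nat \<lceil>r / b\<rceil>"
  have "0 < a * b / (b - a)" using assms by simp
  then have "0 < r" using assms(3) by linarith
  then have "0 < r / b" using assms by simp
  then have n_bounds: "0 < n" "r / b \<le> n" "n < r / b + 1"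
    unfolding n_def by linarith+
  moreover have "r / b + 1 \<le> r / a"
    using assms by (simp add: field_simps)
  ultimately have "n \<le> r / a" by linarith
  with n_bounds assms show "set (replicate n (r / n)) \<subseteq> {a..b}"
    by (auto simp: field_simps)
  show "replicate n (r / n) \<noteq> []" "sum_list (replicate n (r / n)) = r"
    using n_bounds(1) by (simp_all add: sum_list_replicate)
qed

lemma step_pattern_double_twice:
  fixes a b \<beta> :: real
  assumes range: "0 < a" "a < b" and "0 \<le> \<beta>" and pattern: "step_pattern {a..b} d J"
  obtains d' J' r where "step_pattern {a..b} d' J'"
    "\<And>x. cmod (exp_mean (step_sums d') J' x) =
       cmod (exp_mean (step_sums d) J x) * (\<bar>cos (pi * r * x)\<bar> * \<bar>cos (pi * (2 * r + \<beta>) * x)\<bar>)"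
proof -
  define s where "s = a * b / (b - a)"
  obtain e where e_steps: "set e \<subseteq> {a..b}" "e \<noteq> []" "sum_list e = s"
    using exists_steps_with_sum[OF range] by (metis order_refl s_def)
  obtain e' where e'_steps: "set e' \<subseteq> {a..b}" "e' \<noteq> []" "sum_list e' = s + \<beta>"
    using exists_steps_with_sum[OF range, of "s + \<beta>"] \<open>0 \<le> \<beta>\<close> by (auto simp: s_def)
  obtain d1 J1 where once: "step_pattern {a..b} d1 J1" "sum_list d1 = 2 * sum_list d + s"
    "\<And>x. cmod (exp_mean (step_sums d1) J1 x) =
       cmod (exp_mean (step_sums d) J x) * \<bar>cos (pi * (sum_list d + s) * x)\<bar>"
    using step_pattern_double[OF pattern e_steps(1,2)] unfolding e_steps(3) by blast
  obtain d2 J2 where twice: "step_pattern {a..b} d2 J2"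
    "\<And>x. cmod (exp_mean (step_sums d2) J2 x) =
       cmod (exp_mean (step_sums d1) J1 x) * \<bar>cos (pi * (sum_list d1 + (s + \<beta>)) * x)\<bar>"
    using step_pattern_double[OF once(1) e'_steps(1,2)] unfolding e'_steps(3) by blast
  have "sum_list d1 + (s + \<beta>) = 2 * (sum_list d + s) + \<beta>"
    using once(2) by simp
  with once(3) twice show ?thesis
    by (intro that[of d2 J2 "sum_list d + s"]) (simp_all add: mult.assoc)
qed

lemma abs_cos_le_of_abs_sin_ge:
  assumes "0 \<le> \<sigma>" "\<sigma> \<le> \<bar>sin w\<bar>"
  shows "\<bar>cos w\<bar> \<le> sqrt (1 - \<sigma>\<^sup>2)"
proof (rule real_le_rsqrt)
  have "\<sigma>\<^sup>2 \<le> (sin w)\<^sup>2"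
    using assms power_mono[of \<sigma> "\<bar>sin w\<bar>" 2] by simp
  then show "\<bar>cos w\<bar>\<^sup>2 \<le> 1 - \<sigma>\<^sup>2"
    by (simp add: cos_squared_eq)
qed

lemma abs_cos_mult_abs_cos_le:
  assumes "0 \<le> \<sigma>" "\<sigma> \<le> \<bar>sin (v - 2 * u)\<bar>"
  shows "\<bar>cos u\<bar> * \<bar>cos v\<bar> \<le> sqrt (1 - (\<sigma> / 3)\<^sup>2)"
proof -
  have "\<bar>sin (v - 2 * u)\<bar> \<le> \<bar>sin v\<bar> * \<bar>cos (2 * u)\<bar> + \<bar>cos v\<bar> * \<bar>sin (2 * u)\<bar>"
    unfolding sin_diff by (metis abs_mult abs_triangle_ineq4)
  also have "\<dots> \<le> \<bar>sin v\<bar> * 1 + 1 * \<bar>sin (2 * u)\<bar>"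
    by (intro add_mono mult_mono) auto
  also have "\<bar>sin (2 * u)\<bar> \<le> 2 * \<bar>sin u\<bar>"
    by (simp add: sin_double abs_mult mult_left_le)
  finally consider "\<sigma> / 3 \<le> \<bar>sin u\<bar>" | "\<sigma> / 3 \<le> \<bar>sin v\<bar>"
    using assms(2) by linarith
  then have "\<bar>cos u\<bar> \<le> sqrt (1 - (\<sigma> / 3)\<^sup>2) \<or> \<bar>cos v\<bar> \<le> sqrt (1 - (\<sigma> / 3)\<^sup>2)"
    using assms(1) by cases (simp_all add: abs_cos_le_of_abs_sin_ge)
  moreover have "\<bar>cos u\<bar> * \<bar>cos v\<bar> \<le> \<bar>cos u\<bar>" "\<bar>cos u\<bar> * \<bar>cos v\<bar> \<le> \<bar>cos v\<bar>"
    by (simp_all add: mult_left_le mult_left_le_one_le)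
  ultimately show ?thesis by linarith
qed

lemma sin_le_abs_sin:
  fixes c y :: real
  assumes "0 \<le> c" "c \<le> \<bar>y\<bar>" "\<bar>y\<bar> \<le> pi / 2"
  shows "sin c \<le> \<bar>sin y\<bar>"
proof -
  have "sin c \<le> sin \<bar>y\<bar>"
    using assms by (intro sin_monotone_2pi_le) auto
  also have "\<dots> \<le> \<bar>sin y\<bar>"
    by (cases "0 \<le> y") auto
  finally show ?thesis .
qed

lemma exists_cos_product_contraction:
  fixes \<delta> R :: real
  assumes pos: "0 < \<delta>" "0 < R"
  obtains \<beta> q where "0 \<le> \<beta>" "0 \<le> q" "q < 1"
    "\<forall>r x. \<delta> \<le> \<bar>x\<bar> \<and> \<bar>x\<bar> \<le> R \<longrightarrow> \<bar>cos (pi * r * x)\<bar> * \<bar>cos (pi * (2 * r + \<beta>) * x)\<bar> \<le> q"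
proof -
  define \<beta> where "\<beta> = 1 / (2 * (\<delta> + R))"
  define \<sigma> where "\<sigma> = sin (pi * \<beta> * \<delta>)"
  define q where "q = sqrt (1 - (\<sigma> / 3)\<^sup>2)"
  have "0 < \<beta>" using pos by (simp add: \<beta>_def)
  have "pi * \<beta> * \<delta> < pi"
    using pos by (auto simp: \<beta>_def field_simps intro!: add_pos_pos)
  then have "0 < \<sigma>"
    unfolding \<sigma>_def using \<open>0 < \<beta>\<close> pos by (intro sin_gt_zero) simp_all
  moreover have "\<sigma> \<le> 1" by (simp add: \<sigma>_def)
  ultimately have "0 \<le> q" "q < 1"
    by (simp_all add: q_def power_le_one)
  moreover have "\<bar>cos (pi * r * x)\<bar> * \<bar>cos (pi * (2 * r + \<beta>) * x)\<bar> \<le> q"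
    if "\<delta> \<le> \<bar>x\<bar>" "\<bar>x\<bar> \<le> R" for r x
    unfolding q_def
  proof (rule abs_cos_mult_abs_cos_le)
    have "\<beta> * \<bar>x\<bar> \<le> 1 / 2"
      using that pos by (simp add: \<beta>_def field_simps)
    then have "\<bar>pi * \<beta> * x\<bar> \<le> pi / 2"
      using \<open>0 < \<beta>\<close> mult_left_mono[of "\<beta> * \<bar>x\<bar>" "1 / 2" pi] by (simp add: abs_mult)
    moreover have "pi * \<beta> * \<delta> \<le> \<bar>pi * \<beta> * x\<bar>"
      using that \<open>0 < \<beta>\<close> by (simp add: abs_mult)
    ultimately have "\<sigma> \<le> \<bar>sin (pi * \<beta> * x)\<bar>"
      unfolding \<sigma>_def using \<open>0 < \<beta>\<close> pos by (intro sin_le_abs_sin) simp_all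
    moreover have "pi * (2 * r + \<beta>) * x - 2 * (pi * r * x) = pi * \<beta> * x"
      by (simp add: algebra_simps)
    ultimately show "\<sigma> \<le> \<bar>sin (pi * (2 * r + \<beta>) * x - 2 * (pi * r * x))\<bar>"
      by simp
  qed (use \<open>0 < \<sigma>\<close> in simp)
  ultimately show ?thesis
    using \<open>0 < \<beta>\<close> that[of \<beta> q] by simp
qed

lemma exists_step_pattern_small_exp_mean:
  fixes a b \<delta> R \<eta> :: real
  assumes range: "0 < a" "a < b" and pos: "0 < \<delta>" "0 < R" "0 < \<eta>"
  obtains d J where "step_pattern {a..b} d J"
    "\<And>x. \<delta> \<le> \<bar>x\<bar> \<Longrightarrow> \<bar>x\<bar> \<le> R \<Longrightarrow> cmod (exp_mean (step_sums d) J x) \<le> \<eta>"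
proof -
  obtain \<beta> q where "0 \<le> \<beta>" and q_range: "0 \<le> q" "q < 1" and contraction:
    "\<forall>r x. \<delta> \<le> \<bar>x\<bar> \<and> \<bar>x\<bar> \<le> R \<longrightarrow> \<bar>cos (pi * r * x)\<bar> * \<bar>cos (pi * (2 * r + \<beta>) * x)\<bar> \<le> q"
    by (rule exists_cos_product_contraction[OF pos(1,2)])
  have "\<exists>d J. step_pattern {a..b} d J \<and>
      (\<forall>x. \<delta> \<le> \<bar>x\<bar> \<longrightarrow> \<bar>x\<bar> \<le> R \<longrightarrow> cmod (exp_mean (step_sums d) J x) \<le> q ^ n)" for n
  proof (induction n)
    case 0
    have "step_pattern {a..b} [] {0}" by (simp add: step_pattern_def)
    then show ?case
      by (intro exI[of _ "[]"] exI[of _ "{0}"]) (simp add: norm_exp_mean_le_1)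
  next
    case (Suc n)
    then obtain d J where pattern: "step_pattern {a..b} d J"
      and IH: "\<And>x. \<delta> \<le> \<bar>x\<bar> \<Longrightarrow> \<bar>x\<bar> \<le> R \<Longrightarrow> cmod (exp_mean (step_sums d) J x) \<le> q ^ n"
      by blast
    obtain d' J' r where pattern': "step_pattern {a..b} d' J'"
      and exp_mean_d': "\<And>x. cmod (exp_mean (step_sums d') J' x) =
        cmod (exp_mean (step_sums d) J x) * (\<bar>cos (pi * r * x)\<bar> * \<bar>cos (pi * (2 * r + \<beta>) * x)\<bar>)"
      using step_pattern_double_twice[OF range \<open>0 \<le> \<beta>\<close> pattern] by blast
    have "cmod (exp_mean (step_sums d') J' x) \<le> q ^ Suc n" if "\<delta> \<le> \<bar>x\<bar>" "\<bar>x\<bar> \<le> R" for x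
      unfolding exp_mean_d' power_Suc2 using IH[OF that] contraction that q_range
      by (intro mult_mono) simp_all
    with pattern' show ?case by blast
  qed
  moreover obtain n where "q ^ n < \<eta>"
    using real_arch_pow_inv pos q_range by blast
  ultimately show ?thesis
    by (meson that less_imp_le order_trans)
qed

section \<open>Occurrence of patterns in independent sequences\<close>

lemma (in prob_space) AE_exists_notin_indep_events:
  assumes indep: "indep_events E UNIV" and prob_le: "\<And>n. prob (E n) \<le> q" and "q < 1"
  shows "AE \<omega> in M. \<exists>n::nat. \<omega> \<notin> E n"
proof -
  have [measurable]: "E n \<in> events" for n
    using indep by (auto simp: indep_events_def)
  have "prob (\<Inter>n. E n) \<le> q ^ Suc m" for m
  proof -
    have "prob (\<Inter>n. E n) \<le> prob (\<Inter>n\<le>m. E n)"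
      by (intro finite_measure_mono sets.finite_INT) auto
    also have "\<dots> = (\<Prod>n\<le>m. prob (E n))"
      using indep by (auto simp: indep_events_def)
    also have "\<dots> \<le> q ^ Suc m"
      using prod_mono[of "{..m}" "\<lambda>n. prob (E n)" "\<lambda>_. q"] prob_le by simp
    finally show ?thesis .
  qed
  moreover have "0 \<le> q"
    using prob_le[of 0] measure_nonneg order_trans by blast
  then have "(\<lambda>m. q ^ Suc m) \<longlonglongrightarrow> 0"
    using \<open>q < 1\<close> by (intro LIMSEQ_Suc LIMSEQ_power_zero) simp
  ultimately have "prob (\<Inter>n. E n) \<le> 0"
    by (intro LIMSEQ_le_const) auto
  then have "prob (\<Inter>n. E n) = 0"
    using measure_nonneg[of M "\<Inter>n. E n"] by linarith
  then show ?thesis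
    by (subst (asm) prob_eq_0) auto
qed

lemma (in prob_space) indep_events_blocks:
  fixes X :: "nat \<Rightarrow> 'a \<Rightarrow> 'b"
  assumes indep: "indep_vars (\<lambda>_. N) X UNIV" and [measurable]: "\<And>i. i < m \<Longrightarrow> B i \<in> sets N"
  shows "indep_events (\<lambda>l. {\<omega> \<in> space M. \<not> (\<forall>i<m. X (l * m + i) \<omega> \<in> B i)}) UNIV"
proof -
  define block where "block l = {l * m..<l * m + m}" for l
  have "l = j div m" if "j \<in> block l" for j l
    using that unfolding block_def
    by (metis add.commute atLeastLessThan_iff div_nat_eqI mult.commute mult_Suc_right)
  then have "disjoint_family_on block UNIV"
    by (auto simp: disjoint_family_on_def)
  then have "indep_vars (\<lambda>l. PiM (block l) (\<lambda>_. N)) (\<lambda>l \<omega>. restrict (\<lambda>j. X j \<omega>) (block l)) UNIV"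
    by (intro indep_vars_restrict[OF indep]) auto
  then have "indep_events (\<lambda>l. {\<omega> \<in> space M.
      \<not> (\<forall>i<m. restrict (\<lambda>j. X j \<omega>) (block l) (l * m + i) \<in> B i)}) UNIV"
  proof (rule indep_eventsI_indep_vars)
    fix l
    have [measurable]: "(\<lambda>f. f (l * m + i)) \<in> measurable (PiM (block l) (\<lambda>_. N)) N" if "i < m" for i
      using that by (intro measurable_component_singleton) (simp add: block_def)
    show "{f \<in> space (PiM (block l) (\<lambda>_. N)). \<not> (\<forall>i<m. f (l * m + i) \<in> B i)}
        \<in> sets (PiM (block l) (\<lambda>_. N))"
      by measurable
  qed
  also have "(\<lambda>l. {\<omega> \<in> space M. \<not> (\<forall>i<m. restrict (\<lambda>j. X j \<omega>) (block l) (l * m + i) \<in> B i)}) =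
      (\<lambda>l. {\<omega> \<in> space M. \<not> (\<forall>i<m. X (l * m + i) \<omega> \<in> B i)})"
    by (auto simp: block_def)
  finally show ?thesis .
qed

lemma (in prob_space) prob_block_ge:
  fixes X :: "nat \<Rightarrow> 'a \<Rightarrow> 'b"
  assumes indep: "indep_vars (\<lambda>_. N) X UNIV" and B_sets: "\<And>i. i < m \<Longrightarrow> B i \<in> sets N"
    and prob_ge: "0 \<le> p" "\<And>i j. i < m \<Longrightarrow> p \<le> prob (X j -` B i \<inter> space M)"
  shows "p ^ m \<le> prob {\<omega> \<in> space M. \<forall>i<m. X (k + i) \<omega> \<in> B i}"
proof (cases "m = 0")
  case False
  have shift: "{k..<k + m} = (+) k ` {..<m}"
    by (simp add: lessThan_atLeast0 image_add_atLeastLessThan add.commute)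
  have "p ^ m = (\<Prod>j\<in>{k..<k + m}. p)" by simp
  also have "\<dots> \<le> (\<Prod>j\<in>{k..<k + m}. prob (X j -` B (j - k) \<inter> space M))"
    using prob_ge by (intro prod_mono) auto
  also have "\<dots> = prob (\<Inter>j\<in>{k..<k + m}. X j -` B (j - k) \<inter> space M)"
    using False by (intro indep_varsD[OF indep, symmetric]) (auto intro: B_sets)
  also have "(\<Inter>j\<in>{k..<k + m}. X j -` B (j - k) \<inter> space M) = {\<omega> \<in> space M. \<forall>i<m. X (k + i) \<omega> \<in> B i}"
    using False unfolding shift by auto
  finally show ?thesis .
qed (simp add: prob_space)

lemma (in prob_space) AE_exists_block:
  fixes X :: "nat \<Rightarrow> 'a \<Rightarrow> 'b"
  assumes indep: "indep_vars (\<lambda>_. N) X UNIV" and B_sets: "\<And>i. i < m \<Longrightarrow> B i \<in> sets N"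
    and prob_ge: "0 < p" "\<And>i j. i < m \<Longrightarrow> p \<le> prob (X j -` B i \<inter> space M)"
  shows "AE \<omega> in M. \<exists>k. \<forall>i<m. X (k + i) \<omega> \<in> B i"
proof -
  define miss where "miss l = {\<omega> \<in> space M. \<not> (\<forall>i<m. X (l * m + i) \<omega> \<in> B i)}" for l
  have indep_miss: "indep_events miss UNIV"
    unfolding miss_def using indep B_sets by (rule indep_events_blocks)
  have "AE \<omega> in M. \<exists>l. \<omega> \<notin> miss l"
  proof (rule AE_exists_notin_indep_events[OF indep_miss])
    fix l
    have "miss l \<in> events"
      using indep_miss by (auto simp: indep_events_def)
    moreover have "{\<omega> \<in> space M. \<forall>i<m. X (l * m + i) \<omega> \<in> B i} = space M - miss l"
      by (auto simp: miss_def)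
    ultimately show "prob (miss l) \<le> 1 - p ^ m"
      using prob_block_ge[OF indep B_sets less_imp_le[OF prob_ge(1)] prob_ge(2), of m "\<lambda>i. i" "l * m"]
      by (simp add: prob_compl)
  qed (use prob_ge(1) in simp)
  then show ?thesis
    using AE_space by eventually_elim (auto simp: miss_def)
qed

lemma uniform_measure_ball_ge:
  fixes a b c \<epsilon> :: real
  assumes "a < b" "c \<in> {a..b}" "0 < \<epsilon>"
  shows "min (\<epsilon> / (b - a)) (1 / 2) \<le> measure (uniform_measure lborel {a..b}) (ball c \<epsilon>)"
proof -
  define r where "r = min \<epsilon> ((b - a) / 2)"
  have r_bounds: "0 < r" "r \<le> \<epsilon>" "r \<le> (b - a) / 2"
    using assms by (auto simp: r_def min_def)
  obtain l where subset: "{l<..<l + r} \<subseteq> {a..b} \<inter> ball c \<epsilon>"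
  proof (cases "c + r \<le> b")
    case True
    then show ?thesis
      using r_bounds assms(2) by (intro that[of c]) (auto simp: dist_real_def)
  next
    case False
    then show ?thesis
      using r_bounds assms(2) by (intro that[of "c - r"]) (auto simp: dist_real_def)
  qed
  have "{a..b} \<inter> ball c \<epsilon> \<in> fmeasurable lborel"
    by (rule fmeasurableI2[of "{a..b}"]) (auto intro!: fmeasurableI simp: emeasure_lborel_Icc_eq)
  then have "measure lborel {l<..<l + r} \<le> measure lborel ({a..b} \<inter> ball c \<epsilon>)"
    by (intro measure_mono_fmeasurable[OF subset]) auto
  then have "r / (b - a) \<le> measure lborel ({a..b} \<inter> ball c \<epsilon>) / (b - a)"
    using r_bounds(1) assms(1) by (simp add: divide_right_mono)
  moreover have "r / (b - a) = min (\<epsilon> / (b - a)) (1 / 2)"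
    using assms(1) by (auto simp: r_def min_def field_simps)
  ultimately show ?thesis
    using assms(1) by (subst measure_uniform_measure) auto
qed

lemma norm_exp_mean_shifted_le:
  fixes y :: "nat \<Rightarrow> real" and \<epsilon> :: real
  assumes J_subset: "J \<subseteq> {..length d}" and "0 \<le> \<epsilon>"
    and close: "\<And>i. i < length d \<Longrightarrow> \<bar>y (k + i) - d ! i\<bar> \<le> \<epsilon>"
  shows "cmod (exp_mean (\<lambda>n. \<Sum>i<n. y i) ((+) k ` J) x) \<le>
    cmod (exp_mean (step_sums d) J x) + 2 * pi * (length d * \<epsilon>) * \<bar>x\<bar>"
proof -
  define z where "z n = (\<Sum>i<n. y (k + i))" for n
  have z_close: "\<bar>z n - step_sums d n\<bar> \<le> length d * \<epsilon>" if "n \<in> J" for n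
  proof -
    have "n \<le> length d" using J_subset that by auto
    then have "step_sums d n = (\<Sum>i<n. d ! i)"
      by (simp add: step_sums_def sum_list_sum_nth lessThan_atLeast0 min_def)
    then have "\<bar>z n - step_sums d n\<bar> = \<bar>\<Sum>i<n. y (k + i) - d ! i\<bar>"
      by (simp add: z_def sum_subtractf)
    also have "\<dots> \<le> (\<Sum>i<n. \<bar>y (k + i) - d ! i\<bar>)"
      by (rule sum_abs)
    also have "\<dots> \<le> n * \<epsilon>"
      using \<open>n \<le> length d\<close> close sum_mono[of "{..<n}" "\<lambda>i. \<bar>y (k + i) - d ! i\<bar>" "\<lambda>_. \<epsilon>"] by simp
    also have "\<dots> \<le> length d * \<epsilon>"
      using \<open>n \<le> length d\<close> \<open>0 \<le> \<epsilon>\<close> by (simp add: mult_right_mono)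
    finally show ?thesis .
  qed
  have "(\<Sum>i<k + n. y i) = (\<Sum>i<k. y i) + z n" for n
    by (induction n) (simp_all add: z_def)
  then have "exp_mean (\<lambda>n. \<Sum>i<n. y i) ((+) k ` J) x = cis (2 * pi * (\<Sum>i<k. y i) * x) * exp_mean z J x"
    by (simp add: exp_mean_reindex exp_mean_translate)
  then have "cmod (exp_mean (\<lambda>n. \<Sum>i<n. y i) ((+) k ` J) x) = cmod (exp_mean z J x)"
    by (simp add: norm_mult)
  also have "\<dots> \<le> cmod (exp_mean (step_sums d) J x) + cmod (exp_mean z J x - exp_mean (step_sums d) J x)"
    by (metis add.commute diff_add_cancel norm_triangle_ineq)
  also have "cmod (exp_mean z J x - exp_mean (step_sums d) J x) \<le> 2 * pi * (length d * \<epsilon>) * \<bar>x\<bar>"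
    using z_close \<open>0 \<le> \<epsilon>\<close> by (intro norm_exp_mean_diff_le) simp_all
  finally show ?thesis by simp
qed

lemma (in prob_space) AE_exists_small_exp_mean:
  fixes X :: "nat \<Rightarrow> 'a \<Rightarrow> real"
  assumes indep: "indep_vars (\<lambda>_. borel) X UNIV" and range: "0 < a" "a < b"
    and charge: "\<And>\<epsilon>. 0 < \<epsilon> \<Longrightarrow> \<exists>p>0. \<forall>c\<in>{a..b}. \<forall>j. p \<le> prob (X j -` ball c \<epsilon> \<inter> space M)"
    and pos: "0 < \<delta>" "0 < R" "0 < \<eta>"
  shows "AE \<omega> in M. \<exists>J. finite J \<and> J \<noteq> {} \<and>
    (\<forall>x. \<delta> \<le> \<bar>x\<bar> \<and> \<bar>x\<bar> \<le> R \<longrightarrow> cmod (exp_mean (\<lambda>k. \<Sum>i<k. X i \<omega>) J x) \<le> \<eta>)"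
proof -
  obtain d J where pattern: "step_pattern {a..b} d J"
    and small: "\<And>x. \<delta> \<le> \<bar>x\<bar> \<Longrightarrow> \<bar>x\<bar> \<le> R \<Longrightarrow> cmod (exp_mean (step_sums d) J x) \<le> \<eta> / 2"
    using exists_step_pattern_small_exp_mean[OF range pos(1,2) half_gt_zero[OF pos(3)]] by blast
  define \<epsilon> where "\<epsilon> = \<eta> / (4 * pi * R * (length d + 1))"
  have "0 < \<epsilon>" using pos by (simp add: \<epsilon>_def)
  have total_error: "2 * pi * (length d * \<epsilon>) * R \<le> \<eta> / 2"
    using pos by (simp add: \<epsilon>_def divide_simps)
  obtain p where prob_ge: "0 < p" "\<And>c j. c \<in> {a..b} \<Longrightarrow> p \<le> prob (X j -` ball c \<epsilon> \<inter> space M)"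
    using charge[OF \<open>0 < \<epsilon>\<close>] by blast
  have "d ! i \<in> {a..b}" if "i < length d" for i
    using pattern nth_mem[OF that] by (auto simp: step_pattern_def)
  then have "AE \<omega> in M. \<exists>k. \<forall>i<length d. X (k + i) \<omega> \<in> ball (d ! i) \<epsilon>"
    using prob_ge by (intro AE_exists_block[OF indep]) auto
  then show ?thesis
  proof eventually_elim
    case (elim \<omega>)
    then obtain k where "\<forall>i<length d. X (k + i) \<omega> \<in> ball (d ! i) \<epsilon>"
      by blast
    then have close: "\<bar>X (k + i) \<omega> - d ! i\<bar> \<le> \<epsilon>" if "i < length d" for i
      using that by (force simp: dist_real_def)
    have "cmod (exp_mean (\<lambda>k. \<Sum>i<k. X i \<omega>) ((+) k ` J) x) \<le> \<eta>" if "\<delta> \<le> \<bar>x\<bar>" "\<bar>x\<bar> \<le> R" for x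
    proof -
      have "2 * pi * (length d * \<epsilon>) * \<bar>x\<bar> \<le> 2 * pi * (length d * \<epsilon>) * R"
        using that \<open>0 < \<epsilon>\<close> by (intro mult_left_mono) auto
      moreover have "J \<subseteq> {..length d}" using pattern by (simp add: step_pattern_def)
      ultimately show ?thesis
        using norm_exp_mean_shifted_le[OF _ less_imp_le[OF \<open>0 < \<epsilon>\<close>] close, of J x]
          small[OF that] total_error
        by linarith
    qed
    moreover have "finite ((+) k ` J)" "(+) k ` J \<noteq> {}"
      using pattern step_pattern_finite[OF pattern] by (auto simp: step_pattern_def)
    ultimately show ?case by blast
  qed
qed

lemma (in prob_space) AE_vanishing_exp_means_partial_sums:
  fixes X :: "nat \<Rightarrow> 'a \<Rightarrow> real"
  assumes "indep_vars (\<lambda>_. borel) X UNIV" "0 < a" "a < b"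
    and "\<And>\<epsilon>. 0 < \<epsilon> \<Longrightarrow> \<exists>p>0. \<forall>c\<in>{a..b}. \<forall>j. p \<le> prob (X j -` ball c \<epsilon> \<inter> space M)"
  shows "AE \<omega> in M. vanishing_exp_means (\<lambda>k. \<Sum>i<k. X i \<omega>)"
proof -
  have "AE \<omega> in M. \<forall>n. \<exists>J. finite J \<and> J \<noteq> {} \<and>
      (\<forall>x. 1 / real (Suc n) \<le> \<bar>x\<bar> \<and> \<bar>x\<bar> \<le> real (Suc n) \<longrightarrow>
        cmod (exp_mean (\<lambda>k. \<Sum>i<k. X i \<omega>) J x) \<le> 1 / real (Suc n))"
    unfolding AE_all_countable by (intro allI AE_exists_small_exp_mean[OF assms]) auto
  then show ?thesis
    by eventually_elim (rule vanishing_exp_meansI_Suc, blast)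
qed

lemma gam_eq_sum: "gam g1 \<xi> \<omega> k = g1 + (\<Sum>i<k. 1 + \<xi> i \<omega>)"
  by (induction k) simp_all

lemma (in prob_space) AE_vanishing_exp_means_gam:
  fixes \<xi> :: "nat \<Rightarrow> 'a \<Rightarrow> real"
  assumes indep: "indep_vars (\<lambda>_. borel) \<xi> UNIV"
    and distr: "\<And>j. distr M lborel (\<xi> j) = uniform_measure lborel {a..b}"
    and range: "-1 < a" "a < b"
  shows "AE \<omega> in M. vanishing_exp_means (gam g1 \<xi> \<omega>)"
proof -
  have [measurable]: "random_variable borel (\<xi> j)" for j
    using indep by (auto simp: indep_vars_def)
  have prob_ball: "prob ((\<lambda>\<omega>. 1 + \<xi> j \<omega>) -` ball c \<epsilon> \<inter> space M) =
      measure (uniform_measure lborel {a..b}) (ball (c - 1) \<epsilon>)" for j c \<epsilon>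
  proof -
    have "(\<lambda>\<omega>. 1 + \<xi> j \<omega>) -` ball c \<epsilon> = \<xi> j -` ball (c - 1) \<epsilon>"
      by (auto simp: dist_real_def algebra_simps)
    then show ?thesis
      by (simp add: measure_distr flip: distr[of j])
  qed
  have "AE \<omega> in M. vanishing_exp_means (\<lambda>k. \<Sum>i<k. 1 + \<xi> i \<omega>)"
  proof (rule AE_vanishing_exp_means_partial_sums)
    show "indep_vars (\<lambda>_. borel) (\<lambda>i \<omega>. 1 + \<xi> i \<omega>) UNIV"
      using indep by (rule indep_vars_compose2) simp
    fix \<epsilon> :: real assume "0 < \<epsilon>"
    then show "\<exists>p>0. \<forall>c\<in>{1 + a..1 + b}. \<forall>j. p \<le> prob ((\<lambda>\<omega>. 1 + \<xi> j \<omega>) -` ball c \<epsilon> \<inter> space M)"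
      unfolding prob_ball using range
      by (intro exI[of _ "min (\<epsilon> / (b - a)) (1 / 2)"] conjI ballI allI uniform_measure_ball_ge) auto
  qed (use range in auto)
  then show ?thesis
    by (simp add: gam_eq_sum[abs_def] vanishing_exp_means_translate)
qed

section \<open>Column diagonally dominant matrices on absolutely summable families\<close>

definition mat_vec ::
  "('i \<Rightarrow> 'j \<Rightarrow> 'a) \<Rightarrow> 'j set \<Rightarrow> ('j \<Rightarrow> 'a) \<Rightarrow> 'i \<Rightarrow> 'a::{real_normed_div_algebra, banach}" where
  "mat_vec A J w i = (\<Sum>\<^sub>\<infinity>j\<in>J. A i j * w j)"

lemma abs_summable_on_infsum:
  fixes f :: "'i \<times> 'j \<Rightarrow> 'a::banach"
  assumes summable: "(\<lambda>p. norm (f p)) summable_on I \<times> J"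
  shows "(\<lambda>i. norm (\<Sum>\<^sub>\<infinity>j\<in>J. f (i, j))) summable_on I"
    and "(\<Sum>\<^sub>\<infinity>i\<in>I. norm (\<Sum>\<^sub>\<infinity>j\<in>J. f (i, j))) \<le> (\<Sum>\<^sub>\<infinity>p\<in>I \<times> J. norm (f p))"
proof -
  have rows: "(\<lambda>j. norm (f (i, j))) summable_on J" if "i \<in> I" for i
    using summable that by (simp add: Infinite_Sum.abs_summable_on_Sigma_iff)
  have row_sums: "(\<lambda>i. \<Sum>\<^sub>\<infinity>j\<in>J. norm (f (i, j))) summable_on I"
    by (rule summable_on_SigmaD[OF summable rows])
  show norms: "(\<lambda>i. norm (\<Sum>\<^sub>\<infinity>j\<in>J. f (i, j))) summable_on I"
    by (rule Infinite_Sum.abs_summable_on_comparison_test'[OF row_sums norm_infsum_bound[OF rows]])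
  have "(\<Sum>\<^sub>\<infinity>i\<in>I. norm (\<Sum>\<^sub>\<infinity>j\<in>J. f (i, j))) \<le> (\<Sum>\<^sub>\<infinity>i\<in>I. \<Sum>\<^sub>\<infinity>j\<in>J. norm (f (i, j)))"
    by (rule infsum_mono[OF norms row_sums norm_infsum_bound[OF rows]])
  also have "\<dots> = (\<Sum>\<^sub>\<infinity>p\<in>I \<times> J. norm (f p))"
    by (rule infsum_Sigma_banach[OF summable])
  finally show "(\<Sum>\<^sub>\<infinity>i\<in>I. norm (\<Sum>\<^sub>\<infinity>j\<in>J. f (i, j))) \<le> (\<Sum>\<^sub>\<infinity>p\<in>I \<times> J. norm (f p))" .
qed

lemma abs_summable_on_matrix_entries:
  fixes A :: "'i \<Rightarrow> 'j \<Rightarrow> 'a::{real_normed_div_algebra, banach}"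
  assumes col_summable: "\<And>j. j \<in> J \<Longrightarrow> (\<lambda>i. norm (A i j)) summable_on I"
    and col_le: "\<And>j. j \<in> J \<Longrightarrow> (\<Sum>\<^sub>\<infinity>i\<in>I. norm (A i j)) \<le> q"
    and w_summable: "(\<lambda>j. norm (w j)) summable_on J"
  shows "(\<lambda>(i, j). norm (A i j * w j)) summable_on I \<times> J"
    and "(\<Sum>\<^sub>\<infinity>(i, j)\<in>I \<times> J. norm (A i j * w j)) \<le> q * (\<Sum>\<^sub>\<infinity>j\<in>J. norm (w j))"
proof -
  let ?S = "\<lambda>j. \<Sum>\<^sub>\<infinity>i\<in>I. norm (A i j)"
  have cols: "((\<lambda>i. norm (A i j * w j)) has_sum ?S j * norm (w j)) I" if "j \<in> J" for j
    using has_sum_cmult_left[OF has_sum_infsum[OF col_summable[OF that]]] by (simp add: norm_mult)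
  have col_sum_le: "?S j * norm (w j) \<le> q * norm (w j)" if "j \<in> J" for j
    using col_le[OF that] by (simp add: mult_right_mono)
  have qw_summable: "(\<lambda>j. q * norm (w j)) summable_on J"
    by (rule summable_on_cmult_right[OF w_summable])
  then have Sw_summable: "(\<lambda>j. ?S j * norm (w j)) summable_on J"
    by (rule summable_on_comparison_test[OF _ col_sum_le]) (simp_all add: infsum_nonneg)
  then have "(\<lambda>(j, i). norm (A i j * w j)) summable_on J \<times> I"
    by (rule summable_on_SigmaI[rotated]) (use cols in auto)
  then show entries_summable: "(\<lambda>(i, j). norm (A i j * w j)) summable_on I \<times> J"
    by (subst summable_on_swap) (simp add: case_prod_unfold)
  then have "(\<Sum>\<^sub>\<infinity>(i, j)\<in>I \<times> J. norm (A i j * w j)) = (\<Sum>\<^sub>\<infinity>i\<in>I. \<Sum>\<^sub>\<infinity>j\<in>J. norm (A i j * w j))"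
    by (rule infsum_Sigma'_banach[symmetric])
  also have "\<dots> = (\<Sum>\<^sub>\<infinity>j\<in>J. \<Sum>\<^sub>\<infinity>i\<in>I. norm (A i j * w j))"
    by (rule infsum_swap_banach[OF entries_summable])
  also have "\<dots> = (\<Sum>\<^sub>\<infinity>j\<in>J. ?S j * norm (w j))"
    by (intro infsum_cong infsumI cols)
  also have "\<dots> \<le> (\<Sum>\<^sub>\<infinity>j\<in>J. q * norm (w j))"
    by (rule infsum_mono[OF Sw_summable qw_summable col_sum_le])
  also have "\<dots> = q * (\<Sum>\<^sub>\<infinity>j\<in>J. norm (w j))"
    by (rule infsum_cmult_right')
  finally show "(\<Sum>\<^sub>\<infinity>(i, j)\<in>I \<times> J. norm (A i j * w j)) \<le> q * (\<Sum>\<^sub>\<infinity>j\<in>J. norm (w j))" .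
qed

lemma abs_summable_on_mat_vec:
  assumes "\<And>j. j \<in> J \<Longrightarrow> (\<lambda>i. norm (A i j)) summable_on I"
    and "\<And>j. j \<in> J \<Longrightarrow> (\<Sum>\<^sub>\<infinity>i\<in>I. norm (A i j)) \<le> q" and "(\<lambda>j. norm (w j)) summable_on J"
  shows "(\<lambda>i. norm (mat_vec A J w i)) summable_on I"
    and "(\<Sum>\<^sub>\<infinity>i\<in>I. norm (mat_vec A J w i)) \<le> q * (\<Sum>\<^sub>\<infinity>j\<in>J. norm (w j))"
proof -
  let ?f = "\<lambda>(i, j). A i j * w j"
  note entries = abs_summable_on_matrix_entries[of J A I q w, OF assms]
  have "(\<lambda>p. norm (?f p)) summable_on I \<times> J"
    using entries(1) by (simp add: case_prod_unfold)
  note rows = abs_summable_on_infsum[OF this]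
  show "(\<lambda>i. norm (mat_vec A J w i)) summable_on I"
    using rows(1) by (simp add: mat_vec_def)
  show "(\<Sum>\<^sub>\<infinity>i\<in>I. norm (mat_vec A J w i)) \<le> q * (\<Sum>\<^sub>\<infinity>j\<in>J. norm (w j))"
    using order_trans[OF rows(2)] entries(2) by (simp add: mat_vec_def case_prod_unfold)
qed

lemma abs_summable_on_mat_vec_iterates:
  assumes col_summable: "\<And>j. j \<in> I \<Longrightarrow> (\<lambda>i. norm (A i j)) summable_on I"
    and col_le: "\<And>j. j \<in> I \<Longrightarrow> (\<Sum>\<^sub>\<infinity>i\<in>I. norm (A i j)) \<le> q" and q_range: "0 \<le> q" "q < 1"
    and u_summable: "(\<lambda>i. norm (u i)) summable_on I"
  shows "(\<lambda>(n, i). norm ((mat_vec A I ^^ n) u i)) summable_on UNIV \<times> I"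
proof -
  let ?v = "\<lambda>n. (mat_vec A I ^^ n) u"
  have iterates: "(\<lambda>i. norm (?v n i)) summable_on I \<and>
      (\<Sum>\<^sub>\<infinity>i\<in>I. norm (?v n i)) \<le> q ^ n * (\<Sum>\<^sub>\<infinity>i\<in>I. norm (u i))" for n
  proof (induction n)
    case 0
    show ?case using u_summable by simp
  next
    case (Suc n)
    note step = abs_summable_on_mat_vec[OF col_summable col_le conjunct1[OF Suc.IH]]
    note step(2)
    also have "q * (\<Sum>\<^sub>\<infinity>i\<in>I. norm (?v n i)) \<le> q ^ Suc n * (\<Sum>\<^sub>\<infinity>i\<in>I. norm (u i))"
      using mult_left_mono[OF conjunct2[OF Suc.IH] q_range(1)] by (simp add: mult.assoc)
    finally show ?case using step(1) by simp
  qed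
  have "(\<lambda>n. q ^ n) summable_on UNIV"
    using q_range by (simp add: summable_on_UNIV_nonneg_real_iff)
  then have "(\<lambda>n. q ^ n * (\<Sum>\<^sub>\<infinity>i\<in>I. norm (u i))) summable_on UNIV"
    by (rule summable_on_cmult_left)
  then have "(\<lambda>n. \<Sum>\<^sub>\<infinity>i\<in>I. norm (?v n i)) summable_on UNIV"
    by (rule summable_on_comparison_test) (use iterates in \<open>simp_all add: infsum_nonneg\<close>)
  then show ?thesis
    by (rule summable_on_SigmaI[rotated]) (use iterates in auto)
qed

lemma infsum_nat_split_head:
  fixes f :: "nat \<Rightarrow> 'a::banach"
  assumes "f summable_on UNIV"
  shows "(\<Sum>\<^sub>\<infinity>n. f n) = f 0 + (\<Sum>\<^sub>\<infinity>n. f (Suc n))"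
proof -
  have "infsum f UNIV = infsum f (insert 0 (range Suc))"
    by (rule arg_cong[OF UNIV_nat_eq])
  also have "\<dots> = f 0 + infsum f (range Suc)"
    by (intro infsum_insert summable_on_subset_banach[OF assms]) auto
  finally show ?thesis by (simp add: infsum_reindex o_def)
qed

lemma neumann_series_mat_vec:
  fixes A :: "'i \<Rightarrow> 'i \<Rightarrow> 'a::{real_normed_div_algebra, banach}"
  assumes col_summable: "\<And>j. j \<in> I \<Longrightarrow> (\<lambda>i. norm (A i j)) summable_on I"
    and col_le: "\<And>j. j \<in> I \<Longrightarrow> (\<Sum>\<^sub>\<infinity>i\<in>I. norm (A i j)) \<le> q" and q_range: "0 \<le> q" "q < 1"
    and u_summable: "(\<lambda>i. norm (u i)) summable_on I"
  obtains c where "(\<lambda>i. norm (c i)) summable_on I" "\<forall>i\<in>I. c i = u i + mat_vec A I c i"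
proof -
  define v where "v n = (mat_vec A I ^^ n) u" for n
  have v_0: "v 0 = u" and v_Suc: "v (Suc n) = mat_vec A I (v n)" for n
    by (simp_all add: v_def)
  have v_summable: "(\<lambda>(n, i). norm (v n i)) summable_on UNIV \<times> I"
    unfolding v_def by (rule abs_summable_on_mat_vec_iterates[OF col_summable col_le q_range u_summable])
  then have v_swap_summable: "(\<lambda>(i, n). norm (v n i)) summable_on I \<times> UNIV"
    by (subst summable_on_swap) (simp add: case_prod_unfold)
  define c where "c i = (\<Sum>\<^sub>\<infinity>n. v n i)" for i
  have "c i = u i + mat_vec A I c i" if "i \<in> I" for i
  proof -
    have entry_le: "norm (A i j) \<le> q" if "j \<in> I" for j
      using finite_sum_le_infsum[OF col_summable[OF that], of "{i}"] col_le[OF that] \<open>i \<in> I\<close> by simp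
    have "(\<lambda>p. norm (case p of (n, j) \<Rightarrow> A i j * v n j)) summable_on UNIV \<times> I"
      by (rule Infinite_Sum.abs_summable_on_comparison_test'
          [OF summable_on_cmult_right[OF v_summable, of q]])
        (use entry_le in \<open>auto simp: norm_mult mult_right_mono\<close>)
    then have Av_summable: "(\<lambda>(n, j). A i j * v n j) summable_on UNIV \<times> I"
      by (rule abs_summable_summable)
    have "(\<lambda>n. norm (v n i)) summable_on UNIV"
      by (rule summable_on_SigmaD1[OF v_swap_summable \<open>i \<in> I\<close>])
    then have "c i = u i + (\<Sum>\<^sub>\<infinity>n. v (Suc n) i)"
      unfolding c_def by (subst infsum_nat_split_head) (simp_all add: v_0 abs_summable_summable)
    also have "(\<Sum>\<^sub>\<infinity>n. v (Suc n) i) = (\<Sum>\<^sub>\<infinity>j\<in>I. \<Sum>\<^sub>\<infinity>n. A i j * v n j)"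
      unfolding v_Suc mat_vec_def by (rule infsum_swap_banach[OF Av_summable])
    also have "\<dots> = mat_vec A I c i"
      by (simp add: c_def mat_vec_def infsum_cmult_right')
    finally show ?thesis .
  qed
  moreover have "(\<lambda>i. norm (c i)) summable_on I"
    using abs_summable_on_infsum(1)[of "\<lambda>(i, n). v n i" I UNIV] v_swap_summable
    by (simp add: c_def case_prod_unfold)
  ultimately show ?thesis using that by blast
qed

lemma diagonally_dominant_solvable:
  fixes A :: "'i \<Rightarrow> 'i \<Rightarrow> 'a::{real_normed_div_algebra, banach}"
  assumes diag: "\<And>i. i \<in> I \<Longrightarrow> A i i = 1"
    and col_summable: "\<And>j. j \<in> I \<Longrightarrow> (\<lambda>i. norm (A i j)) summable_on I - {j}"
    and col_le: "\<And>j. j \<in> I \<Longrightarrow> (\<Sum>\<^sub>\<infinity>i\<in>I - {j}. norm (A i j)) \<le> q" and q_range: "0 \<le> q" "q < 1"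
    and u_summable: "(\<lambda>i. norm (u i)) summable_on I"
  obtains c where "(\<lambda>i. norm (c i)) summable_on I" "\<forall>i\<in>I. mat_vec A I c i = u i"
proof -
  define B where "B i j = (if i = j then 0 else - A i j)" for i j
  have B_col_summable: "(\<lambda>i. norm (B i j)) summable_on I" if "j \<in> I" for j
    using col_summable[OF that] by (subst summable_on_cong_neutral[of "I - {j}"]) (auto simp: B_def)
  have B_col_le: "(\<Sum>\<^sub>\<infinity>i\<in>I. norm (B i j)) \<le> q" if "j \<in> I" for j
    using col_le[OF that] by (subst infsum_cong_neutral[of "I - {j}"]) (auto simp: B_def)
  obtain c where c_summable: "(\<lambda>i. norm (c i)) summable_on I"
    and c_eq: "\<forall>i\<in>I. c i = u i + mat_vec B I c i"
    by (rule neumann_series_mat_vec[OF B_col_summable B_col_le q_range u_summable])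
  have "mat_vec A I c i = u i" if "i \<in> I" for i
  proof -
    have entry_le: "norm (A i j) \<le> q" if "j \<in> I - {i}" for j
      using finite_sum_le_infsum[OF col_summable, of j "{i}"] col_le[of j] \<open>i \<in> I\<close> that by force
    have "(\<lambda>j. q * norm (c j)) summable_on I - {i}"
      by (intro summable_on_cmult_right summable_on_subset_banach[OF c_summable]) auto
    then have "(\<lambda>j. norm (A i j * c j)) summable_on I - {i}"
      by (rule Infinite_Sum.abs_summable_on_comparison_test')
        (use entry_le in \<open>auto simp: norm_mult mult_right_mono\<close>)
    then have "(\<Sum>\<^sub>\<infinity>j\<in>insert i (I - {i}). A i j * c j) = A i i * c i + (\<Sum>\<^sub>\<infinity>j\<in>I - {i}. A i j * c j)"
      by (rule infsum_insert[OF abs_summable_summable]) simp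
    moreover have "mat_vec B I c i = (\<Sum>\<^sub>\<infinity>j\<in>I - {i}. - (A i j * c j))"
      unfolding mat_vec_def by (intro infsum_cong_neutral) (auto simp: B_def)
    ultimately show ?thesis
      using c_eq[rule_format, OF that] diag[OF that] that
      by (simp add: mat_vec_def insert_absorb infsum_uminus)
  qed
  with c_summable show ?thesis using that by blast
qed

section \<open>Uniformly discrete sets\<close>

lemma uniformly_discrete_iff_uniform_discrete: "uniformly_discrete \<Lambda> \<longleftrightarrow> uniform_discrete \<Lambda>"
  by (force simp: uniformly_discrete_def uniform_discrete_def dist_real_def not_less)

lemma inj_on_floor_divide:
  fixes X :: "real set"
  assumes "0 < \<delta>" "pairwise (\<lambda>x y. \<delta> \<le> \<bar>x - y\<bar>) X"
  shows "inj_on (\<lambda>x. \<lfloor>(x - a) / \<delta>\<rfloor>) X"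
proof (intro inj_onI, rule ccontr)
  fix x y assume same_floor: "x \<in> X" "y \<in> X" "\<lfloor>(x - a) / \<delta>\<rfloor> = \<lfloor>(y - a) / \<delta>\<rfloor>" "x \<noteq> y"
  then have "\<bar>(x - a) / \<delta> - (y - a) / \<delta>\<bar> < 1" by linarith
  then have "\<bar>x - y\<bar> < \<delta>"
    using assms(1) by (simp add: field_simps flip: diff_divide_distrib)
  with assms(2) same_floor show False by (force simp: pairwise_def)
qed

lemma summable_on_inverse_power_int:
  assumes "2 \<le> k"
  shows "(\<lambda>m::int. 1 / \<bar>real_of_int m\<bar> ^ k) summable_on UNIV"
proof -
  let ?f = "\<lambda>m::int. 1 / \<bar>real_of_int m\<bar> ^ k"
  have "summable (\<lambda>n. 1 / real n ^ k)"
    using inverse_power_summable[OF assms, where ?'a = real]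
    by (simp add: inverse_eq_divide power_one_over)
  then have "(\<lambda>n. 1 / real n ^ k) summable_on UNIV"
    by (simp add: summable_on_UNIV_nonneg_real_iff)
  then have "?f summable_on range int" "?f summable_on range (\<lambda>n. - int n)"
    by (simp_all add: summable_on_reindex inj_on_def o_def)
  then have "?f summable_on (range int \<union> range (\<lambda>n. - int n))"
    by (rule summable_on_union)
  also have "range int \<union> range (\<lambda>n. - int n) = UNIV"
    by (auto simp: image_iff) (metis int_cases2)
  finally show ?thesis .
qed

lemma inverse_power_le_inverse_floor_power:
  fixes t \<delta> :: real
  assumes "0 < \<delta>" "\<delta> \<le> \<bar>t\<bar>"
  shows "1 / \<bar>t\<bar> ^ k \<le> (2 / \<delta>) ^ k * (1 / \<bar>real_of_int \<lfloor>t / \<delta>\<rfloor>\<bar> ^ k)"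
proof -
  have "1 \<le> \<bar>t / \<delta>\<bar>"
    using assms by (simp add: abs_divide)
  then have "\<lfloor>t / \<delta>\<rfloor> \<noteq> 0" "\<bar>real_of_int \<lfloor>t / \<delta>\<rfloor>\<bar> \<le> 2 * \<bar>t / \<delta>\<bar>"
    by linarith+
  then have "0 < \<delta> / 2 * \<bar>real_of_int \<lfloor>t / \<delta>\<rfloor>\<bar>" "\<delta> / 2 * \<bar>real_of_int \<lfloor>t / \<delta>\<rfloor>\<bar> \<le> \<bar>t\<bar>"
    using \<open>0 < \<delta>\<close> by (simp_all add: abs_divide field_simps)
  then have "1 / \<bar>t\<bar> ^ k \<le> 1 / (\<delta> / 2 * \<bar>real_of_int \<lfloor>t / \<delta>\<rfloor>\<bar>) ^ k"
    by (intro frac_le power_mono zero_less_power) auto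
  then show ?thesis
    by (simp add: power_mult_distrib power_divide)
qed

lemma separated_summable_on_inverse_power:
  fixes X :: "real set"
  assumes sep: "0 < \<delta>" "pairwise (\<lambda>x y. \<delta> \<le> \<bar>x - y\<bar>) X" and "y \<in> X" and "2 \<le> k"
  shows "(\<lambda>x. 1 / \<bar>x - y\<bar> ^ k) summable_on X - {y}"
    and "(\<Sum>\<^sub>\<infinity>x\<in>X - {y}. 1 / \<bar>x - y\<bar> ^ k) \<le> (2 / \<delta>) ^ k * (\<Sum>\<^sub>\<infinity>m::int. 1 / \<bar>real_of_int m\<bar> ^ k)"
proof -
  let ?m = "\<lambda>x. \<lfloor>(x - y) / \<delta>\<rfloor>"
  define g where "g i = (2 / \<delta>) ^ k * (1 / \<bar>real_of_int i\<bar> ^ k)" for i :: int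
  have le_g: "1 / \<bar>x - y\<bar> ^ k \<le> g (?m x)" if "x \<in> X - {y}" for x
    using inverse_power_le_inverse_floor_power[of \<delta> "x - y" k] sep \<open>y \<in> X\<close> that
    by (auto simp: pairwise_def g_def)
  have inj_floor: "inj_on ?m (X - {y})"
    by (rule inj_on_subset[OF inj_on_floor_divide[OF sep]]) auto
  have g_summable: "g summable_on UNIV"
    unfolding g_def by (intro summable_on_cmult_right summable_on_inverse_power_int \<open>2 \<le> k\<close>)
  then have g_image: "g summable_on ?m ` (X - {y})"
    by (rule summable_on_subset_banach) simp
  then have g_floor: "(\<lambda>x. g (?m x)) summable_on X - {y}"
    by (simp add: summable_on_reindex[OF inj_floor] o_def)
  then show "(\<lambda>x. 1 / \<bar>x - y\<bar> ^ k) summable_on X - {y}"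
    by (rule summable_on_comparison_test) (use le_g in auto)
  then have "(\<Sum>\<^sub>\<infinity>x\<in>X - {y}. 1 / \<bar>x - y\<bar> ^ k) \<le> (\<Sum>\<^sub>\<infinity>x\<in>X - {y}. g (?m x))"
    using g_floor le_g by (rule infsum_mono)
  also have "\<dots> = infsum g (?m ` (X - {y}))"
    by (simp add: infsum_reindex[OF inj_floor] o_def)
  also have "\<dots> \<le> infsum g UNIV"
    using g_image g_summable by (rule infsum_mono2) (use \<open>0 < \<delta>\<close> in \<open>auto simp: g_def\<close>)
  also have "\<dots> = (2 / \<delta>) ^ k * (\<Sum>\<^sub>\<infinity>m::int. 1 / \<bar>real_of_int m\<bar> ^ k)"
    unfolding g_def by (rule infsum_cmult_right')
  finally show "(\<Sum>\<^sub>\<infinity>x\<in>X - {y}. 1 / \<bar>x - y\<bar> ^ k) \<le> (2 / \<delta>) ^ k * (\<Sum>\<^sub>\<infinity>m::int. 1 / \<bar>real_of_int m\<bar> ^ k)" .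
qed

section \<open>Inverse Fourier transforms of bounded functions with bounded support\<close>

definition bounded_supp_funs :: "real set \<Rightarrow> (real \<Rightarrow> complex) set" where
  "bounded_supp_funs S = {F \<in> borel_measurable borel.
     bounded (range F) \<and> bounded {t. F t \<noteq> 0} \<and> {t. F t \<noteq> 0} \<subseteq> S}"

lemma bounded_supp_funsE:
  assumes "F \<in> bounded_supp_funs S"
  obtains C L where "0 \<le> C" "\<And>t. cmod (F t) \<le> C" "\<And>t. t \<notin> {- L..L} \<Longrightarrow> F t = 0"
proof -
  obtain C where F_le: "\<And>t. cmod (F t) \<le> C"
    using assms by (auto simp: bounded_supp_funs_def bounded_iff)
  obtain L where "\<And>t. F t \<noteq> 0 \<Longrightarrow> \<bar>t\<bar> \<le> L"
    using assms by (auto simp: bounded_supp_funs_def bounded_iff)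
  then have "F t = 0" if "t \<notin> {- L..L}" for t
    using that by (force simp: abs_le_iff)
  moreover have "0 \<le> C" using F_le[of 0] norm_ge_zero order_trans by blast
  ultimately show ?thesis using F_le that by blast
qed

lemma bounded_supp_funs_mono: "F \<in> bounded_supp_funs S \<Longrightarrow> S \<subseteq> T \<Longrightarrow> F \<in> bounded_supp_funs T"
  by (auto simp: bounded_supp_funs_def)

lemma bounded_supp_funs_mult:
  assumes F_mem: "F \<in> bounded_supp_funs S"
    and G_bounded: "G \<in> borel_measurable borel" "bounded (range G)"
  shows "(\<lambda>t. F t * G t) \<in> bounded_supp_funs S"
proof -
  obtain C where "\<And>t. cmod (F t) \<le> C" "0 \<le> C" using bounded_supp_funsE[OF F_mem] by metis
  moreover obtain D where "\<And>t. cmod (G t) \<le> D" using G_bounded(2) by (auto simp: bounded_iff)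
  ultimately have "cmod (F t * G t) \<le> C * D" for t
    by (simp add: norm_mult mult_mono)
  then have "bounded (range (\<lambda>t. F t * G t))" by (auto simp: bounded_iff)
  moreover have "bounded {t. F t * G t \<noteq> 0}"
    using F_mem by (auto simp: bounded_supp_funs_def elim: bounded_subset)
  ultimately show ?thesis
    using F_mem G_bounded by (auto simp: bounded_supp_funs_def)
qed

lemma bounded_supp_funs_shift:
  assumes "F \<in> bounded_supp_funs S"
  shows "(\<lambda>t. F (t - a)) \<in> bounded_supp_funs ((+) a ` S)"
proof -
  have "t \<in> (+) a ` {t. F t \<noteq> 0}" if "F (t - a) \<noteq> 0" for t
    using that by (intro image_eqI[of _ _ "t - a"]) auto
  then have supp: "{t. F (t - a) \<noteq> 0} \<subseteq> (+) a ` {t. F t \<noteq> 0}" by blast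
  then have "bounded {t. F (t - a) \<noteq> 0}"
    using assms by (auto simp: bounded_supp_funs_def elim!: bounded_subset[OF bounded_translation])
  moreover have "bounded (range (\<lambda>t. F (t - a)))"
    using assms by (auto simp: bounded_supp_funs_def elim!: bounded_subset)
  ultimately show ?thesis
    using assms supp by (auto simp: bounded_supp_funs_def)
qed

lemma bounded_supp_funs_sum:
  assumes "finite J" "\<And>j. j \<in> J \<Longrightarrow> F j \<in> bounded_supp_funs (S j)"
  shows "(\<lambda>t. \<Sum>j\<in>J. F j t) \<in> bounded_supp_funs (\<Union>j\<in>J. S j)"
proof -
  have F_props: "F j \<in> borel_measurable borel" "bounded (range (F j))" "bounded {t. F j t \<noteq> 0}"
      "{t. F j t \<noteq> 0} \<subseteq> S j" if "j \<in> J" for j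
    using assms(2)[OF that] by (auto simp: bounded_supp_funs_def)
  have "\<forall>j\<in>J. \<exists>C. \<forall>t. cmod (F j t) \<le> C"
    using F_props(2) by (auto simp: bounded_iff)
  then obtain C where "\<And>j t. j \<in> J \<Longrightarrow> cmod (F j t) \<le> C j"
    by metis
  then have "cmod (\<Sum>j\<in>J. F j t) \<le> (\<Sum>j\<in>J. C j)" for t
    by (rule sum_norm_le)
  then have "bounded (range (\<lambda>t. \<Sum>j\<in>J. F j t))"
    by (auto simp: bounded_iff)
  moreover have supp: "{t. (\<Sum>j\<in>J. F j t) \<noteq> 0} \<subseteq> (\<Union>j\<in>J. {t. F j t \<noteq> 0})"
    by (auto elim: sum.not_neutral_contains_not_neutral)
  then have "{t. (\<Sum>j\<in>J. F j t) \<noteq> 0} \<subseteq> (\<Union>j\<in>J. S j)"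
    using F_props(4) by blast
  moreover have "bounded {t. (\<Sum>j\<in>J. F j t) \<noteq> 0}"
    using assms(1) F_props(3) by (intro bounded_subset[OF _ supp] bounded_UN) auto
  ultimately show ?thesis
    using F_props(1) by (auto simp: bounded_supp_funs_def)
qed

lemma bounded_supp_funs_integrable:
  assumes "F \<in> bounded_supp_funs S"
  shows "integrable lborel F"
proof -
  obtain C L where "\<And>t. cmod (F t) \<le> C" "\<And>t. t \<notin> {- L..L} \<Longrightarrow> F t = 0"
    using bounded_supp_funsE[OF assms] by metis
  moreover have "F \<in> borel_measurable lborel"
    using assms by (simp add: bounded_supp_funs_def)
  ultimately show ?thesis
    by (intro integrableI_bounded_set[of "{- L..L}" _ _ C]) (auto simp: emeasure_lborel_Icc_eq)
qed

lemma inv_fourier_mem_W_space: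
  assumes F_mem: "F \<in> bounded_supp_funs S" and "0 \<le> \<alpha>"
  shows "inv_fourier F \<in> W_space \<alpha> S"
proof -
  obtain C L where F_le: "0 \<le> C" "\<And>t. cmod (F t) \<le> C"
    and F_eq_0: "\<And>t. t \<notin> {- L..L} \<Longrightarrow> F t = 0"
    using bounded_supp_funsE[OF F_mem] by metis
  define B where "B = (1 + L powr (2 * \<alpha>)) * C\<^sup>2"
  have "ennreal ((1 + \<bar>t\<bar> powr (2 * \<alpha>)) * (cmod (F t))\<^sup>2) \<le> ennreal B * indicator {- L..L} t" for t
  proof (cases "t \<in> {- L..L}")
    case True
    then have "(1 + \<bar>t\<bar> powr (2 * \<alpha>)) * (cmod (F t))\<^sup>2 \<le> B"
      unfolding B_def using F_le \<open>0 \<le> \<alpha>\<close> by (intro mult_mono add_left_mono powr_mono2 power_mono) auto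
    with True show ?thesis by (simp add: ennreal_leI)
  qed (simp add: F_eq_0)
  then have "(\<integral>\<^sup>+ t. ennreal ((1 + \<bar>t\<bar> powr (2 * \<alpha>)) * (cmod (F t))\<^sup>2) \<partial>lborel)
      \<le> (\<integral>\<^sup>+ t. ennreal B * indicator {- L..L} t \<partial>lborel)"
    by (rule nn_integral_mono)
  also have "\<dots> < \<infinity>"
    by (simp add: nn_integral_cmult_indicator emeasure_lborel_Icc_eq ennreal_mult_less_top)
  finally show ?thesis
    using F_mem unfolding W_space_def bounded_supp_funs_def by (auto intro!: exI[of _ F])
qed

lemma integrable_cis_mult:
  fixes F :: "real \<Rightarrow> complex"
  assumes "integrable lborel F"
  shows "integrable lborel (\<lambda>t. cis (2 * pi * t * x) * F t)"
proof -
  have [measurable]: "(\<lambda>t. cis (2 * pi * t * x)) \<in> borel_measurable borel"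
    by (intro borel_measurable_continuous_onI continuous_intros)
  show ?thesis
    by (rule Bochner_Integration.integrable_bound[OF assms]) (use assms in \<open>auto simp: norm_mult\<close>)
qed

lemma inv_fourier_shift: "inv_fourier (\<lambda>t. F (t - a)) x = cis (2 * pi * a * x) * inv_fourier F x"
proof -
  have "inv_fourier (\<lambda>t. F (t - a)) x =
      (\<integral>t. cis (2 * pi * (a + 1 * t) * x) * F (a + 1 * t - a) \<partial>lborel)"
    unfolding inv_fourier_def by (subst lborel_integral_real_affine[where c = 1 and t = a]) auto
  also have "\<dots> = (\<integral>t. cis (2 * pi * a * x) * (cis (2 * pi * t * x) * F t) \<partial>lborel)"
    by (simp add: distrib_left distrib_right mult.assoc flip: cis_mult)
  finally show ?thesis by (simp add: inv_fourier_def)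
qed

lemma integral_infsum:
  fixes f :: "'i \<Rightarrow> 'a \<Rightarrow> 'b::{banach, second_countable_topology}"
  assumes countable: "countable I" and integrable: "\<And>i. i \<in> I \<Longrightarrow> integrable M (f i)"
    and summable: "\<And>x. x \<in> space M \<Longrightarrow> (\<lambda>i. norm (f i x)) summable_on I"
    and summable_int: "(\<lambda>i. \<integral>x. norm (f i x) \<partial>M) summable_on I"
  shows "(\<integral>x. (\<Sum>\<^sub>\<infinity>i\<in>I. f i x) \<partial>M) = (\<Sum>\<^sub>\<infinity>i\<in>I. \<integral>x. f i x \<partial>M)"
proof (cases "finite I")
  case True
  then show ?thesis using integrable by simp
next
  case False
  define e where "e = from_nat_into I"
  have bij_e: "bij_betw e UNIV I"
    unfolding e_def by (rule bij_betw_from_nat_into[OF countable False])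
  have infsum_eq: "(\<Sum>\<^sub>\<infinity>i\<in>I. g i) = (\<Sum>n. g (e n))" if "(\<lambda>i. norm (g i)) summable_on I" for g :: "'i \<Rightarrow> 'b"
  proof -
    have "(g has_sum (\<Sum>\<^sub>\<infinity>i\<in>I. g i)) I"
      using that by (intro has_sum_infsum) (rule abs_summable_summable)
    then have "((\<lambda>n. g (e n)) has_sum (\<Sum>\<^sub>\<infinity>i\<in>I. g i)) UNIV"
      by (simp add: has_sum_reindex_bij_betw[OF bij_e])
    then show ?thesis
      by (simp add: has_sum_imp_sums sums_unique)
  qed
  have summable_e: "summable (\<lambda>n. g (e n))" if "g summable_on I" for g :: "'i \<Rightarrow> real"
    using that by (intro summable_on_imp_summable) (simp add: summable_on_reindex_bij_betw[OF bij_e])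
  have "(\<integral>x. (\<Sum>\<^sub>\<infinity>i\<in>I. f i x) \<partial>M) = (\<integral>x. (\<Sum>n. f (e n) x) \<partial>M)"
    by (intro Bochner_Integration.integral_cong refl infsum_eq summable)
  also have "\<dots> = (\<Sum>n. \<integral>x. f (e n) x \<partial>M)"
    using bij_e integrable summable summable_int
    by (intro integral_suminf AE_I2 summable_e) (auto simp: bij_betw_def)
  also have "\<dots> = (\<Sum>\<^sub>\<infinity>i\<in>I. \<integral>x. f i x \<partial>M)"
    by (intro infsum_eq[symmetric] integral_norm_bound
        Infinite_Sum.abs_summable_on_comparison_test'[OF summable_int])
  finally show ?thesis .
qed

definition exp_series :: "real set \<Rightarrow> (real \<Rightarrow> complex) \<Rightarrow> real \<Rightarrow> complex" where
  "exp_series X c t = (\<Sum>\<^sub>\<infinity>y\<in>X. c y * cis (- (2 * pi * t * y)))"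

lemma
  assumes c_summable: "(\<lambda>y. cmod (c y)) summable_on X"
  shows bounded_exp_series: "bounded (range (exp_series X c))"
    and borel_measurable_exp_series: "exp_series X c \<in> borel_measurable borel"
proof -
  have "cmod (exp_series X c t) \<le> (\<Sum>\<^sub>\<infinity>y\<in>X. cmod (c y))" for t
    using norm_infsum_bound[of "\<lambda>y. c y * cis (- (2 * pi * t * y))" X] c_summable
    by (simp add: exp_series_def norm_mult)
  then show "bounded (range (exp_series X c))"
    by (auto simp: bounded_iff)
  have "uniform_limit UNIV (\<lambda>Y t. \<Sum>y\<in>Y. c y * cis (- (2 * pi * t * y)))
      (exp_series X c) (finite_subsets_at_top X)"
    unfolding exp_series_def by (rule Weierstrass_m_test_general[OF _ c_summable]) (simp add: norm_mult)
  then have "continuous_on UNIV (exp_series X c)"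
    by (rule uniform_limit_theorem[rotated]) (auto intro!: always_eventually continuous_intros)
  then show "exp_series X c \<in> borel_measurable borel"
    by (rule borel_measurable_continuous_onI)
qed

lemma inv_fourier_mult_exp_series:
  assumes countable: "countable X" and H_integrable: "integrable lborel H"
    and c_summable: "(\<lambda>y. cmod (c y)) summable_on X"
  shows "inv_fourier (\<lambda>t. H t * exp_series X c t) x = (\<Sum>\<^sub>\<infinity>y\<in>X. c y * inv_fourier H (x - y))"
proof -
  define \<phi> where "\<phi> y t = c y * (cis (2 * pi * t * (x - y)) * H t)" for y t
  have norm_\<phi>: "cmod (\<phi> y t) = cmod (c y) * cmod (H t)" for y t
    by (simp add: \<phi>_def norm_mult)
  have "cis (2 * pi * t * x) * (H t * exp_series X c t) = (\<Sum>\<^sub>\<infinity>y\<in>X. \<phi> y t)" for t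
  proof -
    have "cis (2 * pi * t * x) * (H t * exp_series X c t) =
        (\<Sum>\<^sub>\<infinity>y\<in>X. (cis (2 * pi * t * x) * H t) * (c y * cis (- (2 * pi * t * y))))"
      by (simp add: exp_series_def infsum_cmult_right' mult.assoc)
    also have "\<dots> = (\<Sum>\<^sub>\<infinity>y\<in>X. \<phi> y t)"
      by (intro infsum_cong) (simp add: \<phi>_def right_diff_distrib mult_ac cis_mult)
    finally show ?thesis .
  qed
  then have "inv_fourier (\<lambda>t. H t * exp_series X c t) x = (\<integral>t. (\<Sum>\<^sub>\<infinity>y\<in>X. \<phi> y t) \<partial>lborel)"
    by (simp add: inv_fourier_def)
  also have "\<dots> = (\<Sum>\<^sub>\<infinity>y\<in>X. \<integral>t. \<phi> y t \<partial>lborel)"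
  proof (rule integral_infsum[OF countable])
    show "integrable lborel (\<phi> y)" for y
      unfolding \<phi>_def by (intro integrable_mult_right integrable_cis_mult H_integrable)
    show "(\<lambda>y. cmod (\<phi> y t)) summable_on X" "(\<lambda>y. \<integral>t. cmod (\<phi> y t) \<partial>lborel) summable_on X" for t
      unfolding norm_\<phi> using c_summable by (simp_all add: summable_on_cmult_left)
  qed
  also have "\<dots> = (\<Sum>\<^sub>\<infinity>y\<in>X. c y * inv_fourier H (x - y))"
    by (simp add: \<phi>_def inv_fourier_def)
  finally show ?thesis .
qed

section \<open>A bump with cubic Fourier decay\<close>

lemma set_integral_exp_by_parts:
  fixes h h' :: "real \<Rightarrow> complex"
  assumes "a \<le> b" "w \<noteq> 0" "continuous_on {a..b} h'"
    and h_deriv: "\<And>t. (h has_vector_derivative h' t) (at t within {a..b})"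
  shows "(LBINT t:{a..b}. exp (w * t) * h t) =
    (exp (w * b) * h b - exp (w * a) * h a - (LBINT t:{a..b}. exp (w * t) * h' t)) / w"
proof -
  have exp_deriv: "((\<lambda>t. exp (w * of_real t)) has_vector_derivative w * exp (w * t)) (at t within {a..b})"
    for t :: real
    by (auto intro!: derivative_eq_intros has_vector_derivative_real_field)
  then have prod_deriv: "((\<lambda>t. exp (w * of_real t) * h t) has_vector_derivative
      w * (exp (w * t) * h t) + exp (w * t) * h' t) (at t within {a..b})" for t
    using has_vector_derivative_mult[OF exp_deriv h_deriv] by (simp add: algebra_simps)
  have h_cont: "continuous_on {a..b} h"
    using h_deriv by (meson continuous_on_vector_derivative)
  have integrable: "set_integrable lborel {a..b} (\<lambda>t. exp (w * of_real t) * h t)"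
      "set_integrable lborel {a..b} (\<lambda>t. exp (w * of_real t) * h' t)"
    by (intro borel_integrable_atLeastAtMost' continuous_intros assms h_cont)+
  have "exp (w * b) * h b - exp (w * a) * h a =
      (LBINT t:{a..b}. w * (exp (w * t) * h t) + exp (w * t) * h' t)"
    unfolding set_lebesgue_integral_def
    by (rule integral_FTC_Icc[symmetric, OF \<open>a \<le> b\<close> prod_deriv]) (intro continuous_intros assms h_cont)
  also have "\<dots> = w * (LBINT t:{a..b}. exp (w * t) * h t) + (LBINT t:{a..b}. exp (w * t) * h' t)"
    using integrable by (simp add: set_integral_add)
  finally show ?thesis
    using \<open>w \<noteq> 0\<close> by (simp add: field_simps)
qed

lemma norm_set_integral_Icc_le:
  fixes g :: "real \<Rightarrow> 'a::{banach, second_countable_topology}"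
  assumes "a \<le> b" "continuous_on {a..b} g" "\<And>t. t \<in> {a..b} \<Longrightarrow> norm (g t) \<le> C"
  shows "norm (LBINT t:{a..b}. g t) \<le> (b - a) * C"
proof -
  have integrable: "set_integrable lborel {a..b} g"
    using assms(2) by (rule borel_integrable_atLeastAtMost')
  then have "norm (LBINT t:{a..b}. g t) \<le> (LBINT t:{a..b}. norm (g t))"
    by (rule set_integral_norm_bound)
  also have "\<dots> \<le> (LBINT t:{a..b}. C)"
    using assms(3)
    by (intro set_integral_mono set_integrable_norm integrable
        borel_integrable_atLeastAtMost' continuous_intros)
  also have "\<dots> = (b - a) * C"
    using \<open>a \<le> b\<close> by (simp add: set_integral_const)
  finally show ?thesis .
qed

lemma norm_set_integral_exp_cubic_decay:
  fixes h h1 h2 h3 :: "real \<Rightarrow> complex"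
  assumes a_le_b: "a \<le> b" and w_imaginary: "w \<noteq> 0" "Re w = 0"
    and h_deriv: "\<And>t. (h has_vector_derivative h1 t) (at t within {a..b})"
    and h1_deriv: "\<And>t. (h1 has_vector_derivative h2 t) (at t within {a..b})"
    and h2_deriv: "\<And>t. (h2 has_vector_derivative h3 t) (at t within {a..b})"
    and h3_bounded: "continuous_on {a..b} h3" "\<And>t. t \<in> {a..b} \<Longrightarrow> cmod (h3 t) \<le> C"
    and boundary: "h a = 0" "h b = 0" "h1 a = 0" "h1 b = 0"
  shows "cmod (LBINT t:{a..b}. exp (w * t) * h t) \<le>
    (cmod (h2 a) + cmod (h2 b) + (b - a) * C) / cmod w ^ 3"
proof -
  let ?I = "\<lambda>g :: real \<Rightarrow> complex. LBINT t:{a..b}. exp (w * of_real t) * g t"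
  have cont: "continuous_on {a..b} h1" "continuous_on {a..b} h2"
    using h1_deriv h2_deriv by (meson continuous_on_vector_derivative)+
  have "cmod (?I h3) \<le> (b - a) * C"
    using w_imaginary(2) h3_bounded
    by (intro norm_set_integral_Icc_le a_le_b continuous_intros) (auto simp: norm_mult)
  moreover have "cmod (exp (w * of_real b) * h2 b - exp (w * of_real a) * h2 a - ?I h3) \<le>
      cmod (exp (w * of_real b) * h2 b) + cmod (exp (w * of_real a) * h2 a) + cmod (?I h3)"
    by (intro order_trans[OF norm_triangle_ineq4] add_mono norm_triangle_ineq4 order_refl)
  ultimately have "cmod (exp (w * of_real b) * h2 b - exp (w * of_real a) * h2 a - ?I h3) \<le>
      cmod (h2 a) + cmod (h2 b) + (b - a) * C"
    using w_imaginary(2) by (simp add: norm_mult)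
  moreover have "?I h = - ?I h1 / w"
    using set_integral_exp_by_parts[OF a_le_b w_imaginary(1) cont(1) h_deriv] by (simp add: boundary)
  moreover have "?I h1 = - ?I h2 / w"
    using set_integral_exp_by_parts[OF a_le_b w_imaginary(1) cont(2) h1_deriv] by (simp add: boundary)
  moreover have "?I h2 = (exp (w * of_real b) * h2 b - exp (w * of_real a) * h2 a - ?I h3) / w"
    by (rule set_integral_exp_by_parts[OF a_le_b w_imaginary(1) h3_bounded(1) h2_deriv])
  ultimately show ?thesis
    by (simp add: norm_divide norm_mult power3_eq_cube divide_right_mono)
qed

definition bump :: "real \<Rightarrow> complex" where
  "bump t = indicator {0..1} t *\<^sub>R of_real (30 * t\<^sup>2 * (1 - t)\<^sup>2)"

lemma bump_mem_bounded_supp_funs: "bump \<in> bounded_supp_funs {0..1}"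
proof -
  have "cmod (bump t) \<le> 30" for t
  proof (cases "t \<in> {0..1}")
    case True
    then have "t\<^sup>2 * (1 - t)\<^sup>2 \<le> 1 * 1"
      by (intro mult_mono power_le_one) auto
    with True show ?thesis
      by (simp add: bump_def norm_mult norm_power flip: of_real_diff)
  qed (simp add: bump_def)
  moreover have supp: "{t. bump t \<noteq> 0} \<subseteq> {0..1}"
    by (auto simp: bump_def indicator_def split: if_splits)
  moreover have "bounded {t. bump t \<noteq> 0}"
    by (rule bounded_subset[OF bounded_closed_interval supp])
  moreover have "bump \<in> borel_measurable borel"
    unfolding bump_def by measurable
  ultimately show ?thesis
    by (auto simp: bounded_supp_funs_def bounded_iff)
qed

lemma inv_fourier_bump:
  "inv_fourier bump x = (LBINT t:{0..1}. exp (2 * pi * x * \<i> * t) * of_real (30 * t\<^sup>2 * (1 - t)\<^sup>2))"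
  unfolding inv_fourier_def set_lebesgue_integral_def
  by (intro Bochner_Integration.integral_cong) (simp_all add: bump_def cis_conv_exp mult_ac)

lemma has_vector_derivative_complex_of_real:
  assumes "(p has_real_derivative p') (at t within S)"
  shows "((\<lambda>t. complex_of_real (p t)) has_vector_derivative of_real p') (at t within S)"
  using assms
  by (intro has_vector_derivative_of_real) (simp add: has_real_derivative_iff_has_vector_derivative)

lemma inv_fourier_bump_0: "inv_fourier bump 0 = 1"
proof -
  let ?\<Phi> = "\<lambda>t::real. 10 * t ^ 3 - 15 * t ^ 4 + 6 * t ^ 5"
  have "(LBINT t:{0..1::real}. complex_of_real (30 * t\<^sup>2 * (1 - t)\<^sup>2)) =
      of_real (?\<Phi> 1) - of_real (?\<Phi> 0)"
    unfolding set_lebesgue_integral_def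
  proof (rule integral_FTC_Icc)
    fix t :: real
    have "(?\<Phi> has_real_derivative 30 * t\<^sup>2 * (1 - t)\<^sup>2) (at t within {0..1})"
      by (auto intro!: derivative_eq_intros
          simp: algebra_simps power2_eq_square power3_eq_cube power4_eq_xxxx)
    then show "((\<lambda>t. complex_of_real (?\<Phi> t)) has_vector_derivative
        of_real (30 * t\<^sup>2 * (1 - t)\<^sup>2)) (at t within {0..1})"
      by (rule has_vector_derivative_complex_of_real)
  qed (auto intro!: continuous_intros)
  then show ?thesis by (simp add: inv_fourier_bump)
qed

lemma norm_inv_fourier_bump_le:
  assumes "x \<noteq> 0"
  shows "cmod (inv_fourier bump x) \<le> 480 / \<bar>x\<bar> ^ 3"
proof -
  let ?w = "2 * pi * x * \<i>"
  let ?h = "\<lambda>t::real. complex_of_real (30 * t\<^sup>2 * (1 - t)\<^sup>2)"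
  let ?h1 = "\<lambda>t::real. complex_of_real (30 * (2 * t - 6 * t\<^sup>2 + 4 * t ^ 3))"
  let ?h2 = "\<lambda>t::real. complex_of_real (30 * (2 - 12 * t + 12 * t\<^sup>2))"
  let ?h3 = "\<lambda>t::real. complex_of_real (30 * (- 12 + 24 * t))"
  have "cmod (LBINT t:{0..1}. exp (?w * t) * ?h t) \<le>
      (cmod (?h2 0) + cmod (?h2 1) + (1 - 0) * 360) / cmod ?w ^ 3"
  proof (rule norm_set_integral_exp_cubic_decay)
    show "(?h has_vector_derivative ?h1 t) (at t within {0..1})"
      "(?h1 has_vector_derivative ?h2 t) (at t within {0..1})"
      "(?h2 has_vector_derivative ?h3 t) (at t within {0..1})" for t
      by (rule has_vector_derivative_complex_of_real;
          auto intro!: derivative_eq_intros simp: algebra_simps power2_eq_square power3_eq_cube)+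
    show "cmod (?h3 t) \<le> 360" if "t \<in> {0..1}" for t
      using that by (simp only: norm_of_real) (simp add: abs_le_iff)
  qed (use assms in \<open>auto intro!: continuous_intros\<close>)
  also have "\<dots> = 480 / (2 * pi * \<bar>x\<bar>) ^ 3"
    by (simp add: norm_mult)
  also have "\<dots> \<le> 480 / \<bar>x\<bar> ^ 3"
  proof -
    have "\<bar>x\<bar> \<le> 2 * pi * \<bar>x\<bar>"
      using pi_ge_two mult_right_mono[of 1 "2 * pi" "\<bar>x\<bar>"] by simp
    then show ?thesis
      using assms by (intro frac_le power_mono) auto
  qed
  finally show ?thesis by (simp add: inv_fourier_bump)
qed

section \<open>Interpolation on uniformly discrete sets\<close>

definition admits_concentrated_kernels :: "real set \<Rightarrow> bool" where
  "admits_concentrated_kernels S \<longleftrightarrow> (\<forall>\<delta>>0. \<forall>\<kappa>>0. \<exists>H\<in>bounded_supp_funs S.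
     inv_fourier H 0 = 1 \<and> (\<forall>x. \<delta> \<le> \<bar>x\<bar> \<longrightarrow> cmod (inv_fourier H x) \<le> \<kappa> / \<bar>x\<bar>\<^sup>2))"

lemma inv_fourier_bump_mean:
  "inv_fourier (\<lambda>t. (\<Sum>j\<in>J. bump (t - \<gamma> j)) * (1 / of_nat (card J))) x =
    exp_mean \<gamma> J x * inv_fourier bump x"
proof -
  have integrable: "integrable lborel (\<lambda>t. cis (2 * pi * t * x) * bump (t - \<gamma> j))" for j
    by (intro integrable_cis_mult
        bounded_supp_funs_integrable[OF bounded_supp_funs_shift[OF bump_mem_bounded_supp_funs]])
  have "inv_fourier (\<lambda>t. (\<Sum>j\<in>J. bump (t - \<gamma> j)) * (1 / of_nat (card J))) x =
      (\<integral>t. (\<Sum>j\<in>J. cis (2 * pi * t * x) * bump (t - \<gamma> j)) * (1 / of_nat (card J)) \<partial>lborel)"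
    by (simp add: inv_fourier_def mult.assoc flip: sum_distrib_left)
  also have "\<dots> = (\<Sum>j\<in>J. inv_fourier (\<lambda>t. bump (t - \<gamma> j)) x) / of_nat (card J)"
    using integrable by (simp add: inv_fourier_def)
  also have "\<dots> = exp_mean \<gamma> J x * inv_fourier bump x"
    by (simp add: inv_fourier_shift exp_mean_def flip: sum_distrib_right)
  finally show ?thesis .
qed

lemma admits_concentrated_kernels_UN_intervals:
  assumes vanishing: "vanishing_exp_means \<gamma>"
  shows "admits_concentrated_kernels (\<Union>j. {\<gamma> j..\<gamma> j + 1})"
  unfolding admits_concentrated_kernels_def
proof (intro allI impI)
  fix \<delta> \<kappa> :: real assume "0 < \<delta>" "0 < \<kappa>"
  then obtain J where J_finite: "finite J" "J \<noteq> {}"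
    and small: "\<forall>x. \<delta> \<le> \<bar>x\<bar> \<longrightarrow> cmod (exp_mean \<gamma> J x) \<le> \<kappa> / 480 * \<bar>x\<bar>"
    using vanishing_exp_means_le_linear[OF vanishing, of \<delta> "\<kappa> / 480"] by auto
  define H where "H t = (\<Sum>j\<in>J. bump (t - \<gamma> j)) * (1 / of_nat (card J))" for t
  have "(\<lambda>t. \<Sum>j\<in>J. bump (t - \<gamma> j)) \<in> bounded_supp_funs (\<Union>j\<in>J. (+) (\<gamma> j) ` {0..1})"
    by (rule bounded_supp_funs_sum[OF J_finite(1)
          bounded_supp_funs_shift[OF bump_mem_bounded_supp_funs]])
  then have "H \<in> bounded_supp_funs (\<Union>j\<in>J. (+) (\<gamma> j) ` {0..1})"
    unfolding H_def by (rule bounded_supp_funs_mult) auto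
  then have "H \<in> bounded_supp_funs (\<Union>j. {\<gamma> j..\<gamma> j + 1})"
    by (rule bounded_supp_funs_mono) (auto simp: add.commute)
  moreover have inv_fourier_H: "inv_fourier H x = exp_mean \<gamma> J x * inv_fourier bump x" for x
    unfolding H_def by (rule inv_fourier_bump_mean)
  moreover have "inv_fourier H 0 = 1"
    using J_finite by (simp add: inv_fourier_H exp_mean_0 inv_fourier_bump_0)
  moreover have "cmod (inv_fourier H x) \<le> \<kappa> / \<bar>x\<bar>\<^sup>2" if "\<delta> \<le> \<bar>x\<bar>" for x
  proof -
    have "cmod (inv_fourier H x) \<le> \<kappa> / 480 * \<bar>x\<bar> * (480 / \<bar>x\<bar> ^ 3)"
      unfolding inv_fourier_H norm_mult using small that \<open>0 < \<delta>\<close> \<open>0 < \<kappa>\<close>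
      by (intro mult_mono norm_inv_fourier_bump_le) auto
    also have "\<dots> = \<kappa> / \<bar>x\<bar>\<^sup>2"
      using that \<open>0 < \<delta>\<close> by (simp add: power2_eq_square power3_eq_cube)
    finally show ?thesis .
  qed
  ultimately show "\<exists>H\<in>bounded_supp_funs (\<Union>j. {\<gamma> j..\<gamma> j + 1}).
      inv_fourier H 0 = 1 \<and> (\<forall>x. \<delta> \<le> \<bar>x\<bar> \<longrightarrow> cmod (inv_fourier H x) \<le> \<kappa> / \<bar>x\<bar>\<^sup>2)"
    by blast
qed

lemma inverse_power_kernel_col_sum_le:
  fixes K :: "real \<Rightarrow> 'a::real_normed_vector"
  assumes sep: "0 < \<delta>" "pairwise (\<lambda>x y. \<delta> \<le> \<bar>x - y\<bar>) X" and "y \<in> X"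
    and K_decay: "\<And>x. \<delta> \<le> \<bar>x\<bar> \<Longrightarrow> norm (K x) \<le> \<kappa> / \<bar>x\<bar> ^ k" and "0 \<le> \<kappa>" and "2 \<le> k"
  shows "(\<lambda>x. norm (K (x - y))) summable_on X - {y}"
    and "(\<Sum>\<^sub>\<infinity>x\<in>X - {y}. norm (K (x - y))) \<le>
      \<kappa> * ((2 / \<delta>) ^ k * (\<Sum>\<^sub>\<infinity>m::int. 1 / \<bar>real_of_int m\<bar> ^ k))"
proof -
  have K_le: "norm (K (x - y)) \<le> \<kappa> * (1 / \<bar>x - y\<bar> ^ k)" if "x \<in> X - {y}" for x
    using K_decay[of "x - y"] sep(2) \<open>y \<in> X\<close> that by (auto simp: pairwise_def)
  note powers = separated_summable_on_inverse_power[OF sep \<open>y \<in> X\<close> \<open>2 \<le> k\<close>]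
  have powers_summable: "(\<lambda>x. \<kappa> * (1 / \<bar>x - y\<bar> ^ k)) summable_on X - {y}"
    by (rule summable_on_cmult_right[OF powers(1)])
  then show K_summable: "(\<lambda>x. norm (K (x - y))) summable_on X - {y}"
    by (rule summable_on_comparison_test) (use K_le in auto)
  have "(\<Sum>\<^sub>\<infinity>x\<in>X - {y}. norm (K (x - y))) \<le> (\<Sum>\<^sub>\<infinity>x\<in>X - {y}. \<kappa> * (1 / \<bar>x - y\<bar> ^ k))"
    using K_summable powers_summable K_le by (rule infsum_mono)
  also have "\<dots> = \<kappa> * (\<Sum>\<^sub>\<infinity>x\<in>X - {y}. 1 / \<bar>x - y\<bar> ^ k)"
    by (rule infsum_cmult_right')
  finally show "(\<Sum>\<^sub>\<infinity>x\<in>X - {y}. norm (K (x - y))) \<le>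
      \<kappa> * ((2 / \<delta>) ^ k * (\<Sum>\<^sub>\<infinity>m::int. 1 / \<bar>real_of_int m\<bar> ^ k))"
    using mult_left_mono[OF powers(2) \<open>0 \<le> \<kappa>\<close>] by linarith
qed

lemma exists_bounded_supp_interpolant:
  assumes kernels: "admits_concentrated_kernels S" and discrete: "uniformly_discrete X"
    and u_summable: "(\<lambda>x. cmod (u x)) summable_on X"
  obtains F where "F \<in> bounded_supp_funs S" "\<forall>x\<in>X. inv_fourier F x = u x"
proof -
  obtain \<delta> where sep: "0 < \<delta>" "pairwise (\<lambda>x y. \<delta> \<le> \<bar>x - y\<bar>) X"
    using discrete by (auto simp: uniformly_discrete_def pairwise_def)
  have "countable X"
    using countable_image_inj_on[OF _ inj_on_floor_divide[OF sep]] by simp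
  define B where "B = (2 / \<delta>)\<^sup>2 * (\<Sum>\<^sub>\<infinity>m::int. 1 / \<bar>real_of_int m\<bar>\<^sup>2)"
  define \<kappa> where "\<kappa> = 1 / (2 * (B + 1))"
  have "0 \<le> B" by (auto simp: B_def intro!: mult_nonneg_nonneg infsum_nonneg)
  then have kappa_bounds: "0 < \<kappa>" "\<kappa> * B \<le> 1 / 2" by (auto simp: \<kappa>_def field_simps)
  obtain H where H_kernel: "H \<in> bounded_supp_funs S" "inv_fourier H 0 = 1"
    and H_decay: "\<And>x. \<delta> \<le> \<bar>x\<bar> \<Longrightarrow> cmod (inv_fourier H x) \<le> \<kappa> / \<bar>x\<bar>\<^sup>2"
    using kernels sep(1) kappa_bounds(1) unfolding admits_concentrated_kernels_def by blast
  note col_sums = inverse_power_kernel_col_sum_le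
    [OF sep _ H_decay less_imp_le[OF kappa_bounds(1)] order_refl, folded B_def]
  obtain c where c_summable: "(\<lambda>y. cmod (c y)) summable_on X"
    and c_eq: "\<forall>x\<in>X. mat_vec (\<lambda>x y. inv_fourier H (x - y)) X c x = u x"
  proof (rule diagonally_dominant_solvable)
    show "(\<lambda>x. cmod (inv_fourier H (x - y))) summable_on X - {y}" if "y \<in> X" for y
      using that by (rule col_sums(1))
    show "(\<Sum>\<^sub>\<infinity>x\<in>X - {y}. cmod (inv_fourier H (x - y))) \<le> 1 / 2" if "y \<in> X" for y
      using col_sums(2)[OF that] kappa_bounds(2) by linarith
  qed (use H_kernel(2) u_summable in auto)
  have "(\<lambda>t. H t * exp_series X c t) \<in> bounded_supp_funs S"
    by (intro bounded_supp_funs_mult H_kernel(1) borel_measurable_exp_series bounded_exp_series c_summable)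
  moreover have "inv_fourier (\<lambda>t. H t * exp_series X c t) x = u x" if "x \<in> X" for x
  proof -
    have "inv_fourier (\<lambda>t. H t * exp_series X c t) x = (\<Sum>\<^sub>\<infinity>y\<in>X. c y * inv_fourier H (x - y))"
      by (rule inv_fourier_mult_exp_series
          [OF \<open>countable X\<close> bounded_supp_funs_integrable[OF H_kernel(1)] c_summable])
    then show ?thesis
      using c_eq that by (simp add: mat_vec_def mult.commute)
  qed
  ultimately show ?thesis using that by blast
qed

lemma not_uniqueness_set_W_space:
  assumes kernels: "admits_concentrated_kernels S" and discrete: "uniformly_discrete \<Lambda>" and "0 \<le> \<alpha>"
  shows "\<not> uniqueness_set \<Lambda> (W_space \<alpha> S)"
proof
  assume unique: "uniqueness_set \<Lambda> (W_space \<alpha> S)"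
  obtain \<delta> where "0 < \<delta>" and sep: "\<And>x y. x \<in> \<Lambda> \<Longrightarrow> y \<in> \<Lambda> \<Longrightarrow> x \<noteq> y \<Longrightarrow> \<delta> \<le> \<bar>x - y\<bar>"
    using discrete by (auto simp: uniformly_discrete_def)
  then obtain x\<^sub>0 where "x\<^sub>0 \<notin> \<Lambda>"
    using sep[of 0 "\<delta> / 2"] by force
  have "uniformly_discrete (insert x\<^sub>0 \<Lambda>)"
    using discrete by (simp add: uniformly_discrete_iff_uniform_discrete uniform_discrete_insert)
  moreover have "(\<lambda>x. cmod (of_bool (x = x\<^sub>0))) summable_on insert x\<^sub>0 \<Lambda>"
    by (rule finite_nonzero_values_imp_summable_on) simp
  ultimately obtain F where F_mem: "F \<in> bounded_supp_funs S"
    and F_eq: "\<forall>x\<in>insert x\<^sub>0 \<Lambda>. inv_fourier F x = of_bool (x = x\<^sub>0)"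
    by (rule exists_bounded_supp_interpolant[OF kernels])
  have "inv_fourier F \<in> W_space \<alpha> S"
    using F_mem \<open>0 \<le> \<alpha>\<close> by (rule inv_fourier_mem_W_space)
  moreover have "\<forall>x\<in>\<Lambda>. inv_fourier F x = 0"
    using F_eq \<open>x\<^sub>0 \<notin> \<Lambda>\<close> by auto
  ultimately have "inv_fourier F = (\<lambda>_. 0)"
    using unique by (auto simp: uniqueness_set_def)
  then show False using F_eq by simp
qed

theorem theorem8:
  fixes M :: "'a measure" and \<xi> :: "nat \<Rightarrow> 'a \<Rightarrow> real" and g1 \<alpha> :: real
  assumes "prob_space M"
    and "prob_space.indep_vars M (\<lambda>_. borel) \<xi> UNIV"
    and "\<And>j. distr M lborel (\<xi> j) = uniform_measure lborel {2..3}"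
    and "\<alpha> > 1/2"
  shows "AE \<omega> in M. \<forall>\<Lambda>. uniformly_discrete \<Lambda> \<longrightarrow>
           \<not> uniqueness_set \<Lambda> (W_space \<alpha> (rand_set g1 \<xi> \<omega>))"
proof -
  interpret prob_space M by fact
  have "AE \<omega> in M. vanishing_exp_means (gam g1 \<xi> \<omega>)"
    using assms(2,3) by (rule AE_vanishing_exp_means_gam) auto
  then show ?thesis
  proof eventually_elim
    case (elim \<omega>)
    then have "admits_concentrated_kernels (rand_set g1 \<xi> \<omega>)"
      unfolding rand_set_def by (rule admits_concentrated_kernels_UN_intervals)
    then show ?case
      using assms(4) by (simp add: not_uniqueness_set_W_space)
  qed
qed

end
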